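(* Let $n\ge 3$, $t\in(0,2)$ and $q>1$, and consider the equation $$-\Delta u=|x|^{-t}u^q,\qquad u>0 \text{ in } \mathbb{R}^n. \qquad ( * )$$ (1) If $u\in C^2(\mathbb{R}^n)\cap\mathcal{D}^{1,2}(\mathbb{R}^n)$ solves $( * )$, then $\big\||x|^{-t/(q+1)}u\big\|_{L^{q+1}(\mathbb{R}^n)}^{q+1}<\infty$, and in addition $\big\||x|^{-t/(q+1)}u\big\|_{L^{q+1}(\mathbb{R}^n)}^{q+1}=\|\nabla u\|_{L^2(\mathbb{R}^n)}^2$. (2) Assume $u\in C^2(\mathbb{R}^n)$ solves $( * )$ and $\int_{\mathbb{R}^n}|x|^{-t}u^{q+1}dx<\infty$. If $u\in L^{\frac{2n}{n-2}}(\mathbb{R}^n)$, then $u\in\mathcal{D}^{1,2}(\mathbb{R}^n)$ and $\int_{\mathbb{R}^n}|\nabla u|^2dx=\int_{\mathbb{R}^n}|x|^{-t}u^{q+1}dx$.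
   Context: $\mathcal{D}^{1,2}(\mathbb{R}^n)$ is the homogeneous Sobolev space, i.e. the completion of $C_0^\infty(\mathbb{R}^n)$ with respect to the norm $\|\nabla u\|_{L^2(\mathbb{R}^n)}$. *)

theory Defs
  imports "HOL-Analysis.Analysis"
begin

definition partial_deriv :: "'n::finite \<Rightarrow> (real^'n \<Rightarrow> real) \<Rightarrow> real^'n \<Rightarrow> real" where
  "partial_deriv i f x = frechet_derivative f (at x) (axis i 1)"

definition grad :: "(real^'n::finite \<Rightarrow> real) \<Rightarrow> real^'n \<Rightarrow> real^'n" where
  "grad f x = (\<chi> i. partial_deriv i f x)"

definition laplacian :: "(real^'n::finite \<Rightarrow> real) \<Rightarrow> real^'n \<Rightarrow> real" where
  "laplacian f x = (\<Sum>i\<in>UNIV. partial_deriv i (partial_deriv i f) x)"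

text \<open>The class \<open>C\<^sup>k(S)\<close>, for an open set \<open>S\<close>.\<close>

primrec Ck_on :: "nat \<Rightarrow> (real^'n::finite) set \<Rightarrow> (real^'n \<Rightarrow> real) \<Rightarrow> bool" where
  "Ck_on 0 S f \<longleftrightarrow> continuous_on S f"
| "Ck_on (Suc k) S f \<longleftrightarrow>
     (\<forall>x\<in>S. f differentiable (at x)) \<and> (\<forall>i. Ck_on k S (partial_deriv i f))"

definition test_function :: "(real^'n::finite \<Rightarrow> real) \<Rightarrow> bool" where
  "test_function f \<longleftrightarrow> (\<forall>k. Ck_on k UNIV f) \<and> compact (closure {x. f x \<noteq> 0})"

text \<open>The \<open>p\<close>-th power of the \<open>L\<^sup>p\<close> norm, with values in \<open>[0, \<infinity>]\<close>.\<close>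

definition Lp_norm_pow ::
    "real \<Rightarrow> (real^'n::finite \<Rightarrow> 'b::real_normed_vector) \<Rightarrow> ennreal" where
  "Lp_norm_pow p f = (\<integral>\<^sup>+x. ennreal (norm (f x) powr p) \<partial>lebesgue)"

definition Lp_space :: "real \<Rightarrow> (real^'n::finite \<Rightarrow> real) set" where
  "Lp_space p = {f \<in> borel_measurable lebesgue. Lp_norm_pow p f < \<infinity>}"

text \<open>
  The completion of the test functions under \<open>\<parallel>\<nabla>u\<parallel>\<close> in \<open>L\<^sup>2\<close> (for \<open>n \<ge> 3\<close>). By the Sobolev
  inequality a sequence that is Cauchy for this norm converges in \<open>L\<^sup>p\<close>, \<open>p = 2n/(n-2)\<close>, and
  the element of the completion that it represents is identified with this limit.
\<close>

definition D12 :: "(real^'n::finite \<Rightarrow> real) set" where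
  "D12 = {u \<in> borel_measurable lebesgue. \<exists>\<phi> :: nat \<Rightarrow> real^'n \<Rightarrow> real.
      (\<forall>k. test_function (\<phi> k)) \<and>
      (\<forall>\<epsilon>>0. \<exists>N. \<forall>j\<ge>N. \<forall>k\<ge>N. Lp_norm_pow 2 (grad (\<lambda>x. \<phi> j x - \<phi> k x)) < ennreal \<epsilon>) \<and>
      (\<lambda>k. Lp_norm_pow (2 * real CARD('n) / (real CARD('n) - 2)) (\<lambda>x. \<phi> k x - u x)) \<longlonglongrightarrow> 0}"

text \<open>
  The equation \<open>-\<Delta>u = |x|\<^sup>-\<^sup>t u\<^sup>q\<close>, \<open>u > 0\<close>. Its right-hand side is not defined at the origin,
  so the equation is required at the points \<open>x \<noteq> 0\<close>.
\<close>

definition solves_eq :: "real \<Rightarrow> real \<Rightarrow> (real^'n::finite \<Rightarrow> real) \<Rightarrow> bool" where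
  "solves_eq t q u \<longleftrightarrow>
     (\<forall>x. u x > 0) \<and> (\<forall>x. x \<noteq> 0 \<longrightarrow> - laplacian u x = norm x powr (-t) * u x powr q)"

lemma Ck_on_subset: "Ck_on k S f \<Longrightarrow> T \<subseteq> S \<Longrightarrow> Ck_on k T f"
  by (induction k arbitrary: f) (auto intro: continuous_on_subset)

lemma Ck_on_imp_continuous_on: "Ck_on k S f \<Longrightarrow> continuous_on S f"
  by (cases k)
    (auto intro!: continuous_at_imp_continuous_on differentiable_imp_continuous_within)

text \<open>
  The right-hand side of the equation is unbounded near the origin, so no solution is \<open>C\<^sup>2\<close>
  across the origin. Regularity \<open>u \<in> C\<^sup>2(\<real>\<^sup>n)\<close> of a solution is therefore read as: \<open>u\<close> is
  continuous on the whole space and \<open>C\<^sup>2\<close> off the origin, which is implied by \<open>C\<^sup>2\<close>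
  regularity on the whole space.
\<close>

lemma C2_imp_C2_off_origin:
  "Ck_on 2 UNIV u \<Longrightarrow> continuous_on UNIV u \<and> Ck_on 2 (- {0}) u"
  by (auto intro: Ck_on_imp_continuous_on Ck_on_subset)

lemma no_C2_solution:
  fixes u :: "real^'n::finite \<Rightarrow> real"
  assumes "t > 0" "solves_eq t q u"
  shows "\<not> Ck_on 2 UNIV u"
proof
  assume C2: "Ck_on 2 UNIV u"
  have pos: "u x > 0" for x
    using assms(2) by (simp add: solves_eq_def)
  have cu: "continuous_on UNIV u"
    using C2 by (rule Ck_on_imp_continuous_on)
  have "Ck_on 0 UNIV (partial_deriv i (partial_deriv i u))" for i
    using C2 by (simp add: numeral_2_eq_2)
  then have cl: "continuous_on UNIV (laplacian u)"
    unfolding laplacian_def by (intro continuous_on_sum) auto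
  define g where "g x = - laplacian u x / (u x powr q)" for x
  have "continuous_on UNIV g"
    unfolding g_def using cl cu pos
    by (intro continuous_intros) (auto simp: less_imp_neq[THEN not_sym])
  then have "(g \<longlongrightarrow> g 0) (at 0)"
    by (simp add: continuous_on_def)
  moreover have "((\<lambda>x::real^'n. norm x powr t) \<longlongrightarrow> 0) (at 0)"
    using assms(1) by (intro tendsto_zero_powrI[of _ _ _ t] tendsto_norm_zero) auto
  ultimately have "((\<lambda>x. g x * norm x powr t) \<longlongrightarrow> 0) (at 0)"
    using tendsto_mult by fastforce
  moreover have "g x * norm x powr t = 1" if "x \<noteq> 0" for x
  proof -
    have "g x = norm x powr (- t)"
      using assms(2) less_imp_neq[OF pos[of x]] that unfolding g_def solves_eq_def by auto
    with that show ?thesis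
      by (simp add: powr_minus)
  qed
  then have "\<forall>\<^sub>F x in at 0. g x * norm x powr t = 1"
    by (simp add: eventually_at_filter)
  then have "((\<lambda>x. g x * norm x powr t) \<longlongrightarrow> 1) (at 0)"
    by (rule tendsto_eventually)
  ultimately show False
    using tendsto_unique[of "at (0::real^'n)"] by fastforce
qed

end

theory Submission
  imports Defs
begin

text \<open>
  Let \<open>\<eta>\<close> be a cutoff that vanishes near the origin and near infinity. The field \<open>\<eta>\<^sup>2 u \<nabla>u\<close> is
  \<open>C\<^sup>1\<close> with compact support, so its divergence has integral zero, which gives
  \[ \int \eta^2 |\nabla u|^2 + 2 \int \eta u \nabla\eta \cdot \nabla u = \int \eta^2 |x|^{-t} u^{q+1}. \]
  As \<open>u\<close> lies in \<open>L\<^sup>p\<close> with \<open>p = 2n/(n-2)\<close>, the error \<open>\<integral> u\<^sup>2 |\<nabla>\<eta>|\<^sup>2\<close> tends to zero when the cutoffs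
  exhaust the punctured space (Young's inequality and the scaling of \<open>|\<nabla>\<eta>|\<^sup>n\<close>). Hence if one of the two
  outer integrals stays bounded, so does the other, and they have the same finite limit.

  In part (2) the right-hand side is bounded by hypothesis; then \<open>\<eta>u\<close>, mollified, approximates \<open>u\<close>
  in the sense of \<open>\<D>\<^sup>1\<^sup>,\<^sup>2\<close>. In part (1) the left-hand integral is bounded by testing the gradients of the
  approximating sequence against \<open>\<eta>\<^sup>2 \<nabla>u\<close>.
\<close>

subsection \<open>Gradients and the classes \<open>C\<^sup>k\<close>\<close>

text \<open>Two features of the setting shape the argument. \<open>u\<close> is C^2 only off the
  origin, where the right-hand side is singular, so every integration by parts carries a cutoff that
  removes a ball around the origin; the square on the cutoff lets the cross term be absorbed into
  half of the energy. Moreover, membership in \<open>D12\<close> supplies Cauchy gradients and a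
  limit in L^p, but does not say that these gradients converge to \<open>grad u\<close>. Testing
  with the difference of an approximating function and \<open>u\<close> moves all derivatives onto
  \<eta>^2 grad u, where convergence in L^p suffices, so no weak gradient has to be identified.

  The exponent p is twice the conjugate of n / 2. With it the remainder in Young's inequality is the
  integral of |grad \<eta>|^n, which is invariant under dilations: it stays bounded at the small and
  at the large scale but does not decay. The decay comes from the mass of |u|^p on a shrinking ball
  and a receding shell.\<close>

lemma GDERIV_imp_differentiable: "GDERIV f x :> D \<Longrightarrow> f differentiable at x"
  unfolding gderiv_def differentiable_def by blast

lemma GDERIV_imp_continuous_on:
  assumes "\<And>x. x \<in> S \<Longrightarrow> GDERIV f x :> g x"
  shows "continuous_on S f"
  using assms
  by (meson GDERIV_imp_differentiable continuous_at_imp_continuous_on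
      differentiable_imp_continuous_within)

lemma GDERIV_imp_partial_deriv:
  fixes f :: "real^'n \<Rightarrow> real"
  assumes "GDERIV f x :> D"
  shows "partial_deriv i f x = D $ i"
  using frechet_derivative_at[OF assms[unfolded gderiv_def]]
  unfolding partial_deriv_def by (metis inner_axis inner_commute inner_real_def mult.right_neutral)

lemma GDERIV_imp_grad:
  fixes f :: "real^'n \<Rightarrow> real"
  assumes "GDERIV f x :> D"
  shows "grad f x = D"
  using GDERIV_imp_partial_deriv[OF assms] by (simp add: grad_def vec_eq_iff)

text \<open>\<open>grad\<close> is assembled from partial derivatives, so the full derivative is
  recovered by linearity from its values on the axis vectors.\<close>

lemma differentiable_imp_GDERIV:
  fixes f :: "real^'n \<Rightarrow> real"
  assumes "f differentiable at x"
  shows "GDERIV f x :> grad f x"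
proof -
  let ?D = "frechet_derivative f (at x)"
  have D: "(f has_derivative ?D) (at x)"
    using assms frechet_derivative_works by blast
  then have lin: "linear ?D"
    using has_derivative_linear by blast
  have "?D h = h \<bullet> grad f x" for h
  proof -
    have "?D h = ?D (\<Sum>i\<in>UNIV. (h $ i) *\<^sub>R axis i 1)"
      using basis_expansion[of h] by (simp add: scalar_mult_eq_scaleR)
    also have "\<dots> = (\<Sum>i\<in>UNIV. h $ i * partial_deriv i f x)"
      by (simp add: linear_sum[OF lin] linear_scale[OF lin] partial_deriv_def)
    finally show ?thesis by (simp add: inner_vec_def grad_def)
  qed
  then have "?D = (\<lambda>h. h \<bullet> grad f x)" by blast
  then show ?thesis using D by (simp add: gderiv_def)
qed

lemma continuous_on_vecI:
  fixes g :: "real^'n \<Rightarrow> real^'n"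
  assumes "\<And>i. continuous_on S (\<lambda>x. g x $ i)"
  shows "continuous_on S g"
  by (subst continuous_on_componentwise) (auto simp: Basis_vec_def inner_axis assms)

lemma Ck_on_Suc_imp_Ck_on: "Ck_on (Suc k) S f \<Longrightarrow> Ck_on k S f"
proof (induction k arbitrary: f)
  case 0
  then show ?case using Ck_on_imp_continuous_on[OF 0] by simp
next
  case (Suc k)
  then show ?case by (metis Ck_on.simps(2))
qed

text \<open>Higher regularity is proved from one explicit gradient formula: once its components
  belong to a class closed under the same operation, induction on \<open>k\<close> does the
  rest.\<close>

lemma Ck_on_SucI:
  fixes f :: "real^'n \<Rightarrow> real"
  assumes "\<And>x. GDERIV f x :> g x" and "\<And>i. Ck_on k UNIV (\<lambda>x. g x $ i)"
  shows "Ck_on (Suc k) UNIV f"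
proof -
  have "partial_deriv i f = (\<lambda>x. g x $ i)" for i
    using GDERIV_imp_partial_deriv[OF assms(1)] by blast
  then show ?thesis
    using assms GDERIV_imp_differentiable by (simp, blast)
qed

lemma Ck_on_SucD:
  fixes f :: "real^'n \<Rightarrow> real"
  assumes "Ck_on (Suc k) S f"
  shows "x \<in> S \<Longrightarrow> GDERIV f x :> grad f x" and "Ck_on k S (\<lambda>x. grad f x $ i)"
proof -
  show "x \<in> S \<Longrightarrow> GDERIV f x :> grad f x"
    using assms differentiable_imp_GDERIV by auto
  have "(\<lambda>x. grad f x $ i) = partial_deriv i f" by (auto simp: grad_def)
  then show "Ck_on k S (\<lambda>x. grad f x $ i)" using assms by simp
qed

declare Ck_on.simps(2) [simp del]

lemma Ck_on_const: "Ck_on k UNIV (\<lambda>x::real^'n. c)"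
  by (induction k arbitrary: c) (auto intro!: Ck_on_SucI[OF GDERIV_const])

lemma Ck_on_add:
  fixes f g :: "real^'n \<Rightarrow> real"
  shows "Ck_on k UNIV f \<Longrightarrow> Ck_on k UNIV g \<Longrightarrow> Ck_on k UNIV (\<lambda>x. f x + g x)"
proof (induction k arbitrary: f g)
  case 0
  then show ?case by (auto intro: continuous_intros)
next
  case (Suc k)
  show ?case
    by (rule Ck_on_SucI[OF GDERIV_add[OF Ck_on_SucD(1)[OF Suc.prems(1)] Ck_on_SucD(1)[OF Suc.prems(2)]]])
      (simp_all add: Suc.IH Ck_on_SucD(2)[OF Suc.prems(1)] Ck_on_SucD(2)[OF Suc.prems(2)])
qed

lemma Ck_on_mult:
  fixes f g :: "real^'n \<Rightarrow> real"
  shows "Ck_on k UNIV f \<Longrightarrow> Ck_on k UNIV g \<Longrightarrow> Ck_on k UNIV (\<lambda>x. f x * g x)"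
proof (induction k arbitrary: f g)
  case 0
  then show ?case by (auto intro: continuous_intros)
next
  case (Suc k)
  show ?case
    by (rule Ck_on_SucI[OF GDERIV_mult[OF Ck_on_SucD(1)[OF Suc.prems(1)] Ck_on_SucD(1)[OF Suc.prems(2)]]])
      (simp_all add: Ck_on_add Suc.IH Ck_on_SucD(2)[OF Suc.prems(1)] Ck_on_SucD(2)[OF Suc.prems(2)]
        Ck_on_Suc_imp_Ck_on[OF Suc.prems(1)] Ck_on_Suc_imp_Ck_on[OF Suc.prems(2)])
qed

lemma GDERIV_component: "GDERIV (\<lambda>x::real^'n. x $ i) x :> axis i 1"
  unfolding gderiv_def inner_axis
  by (auto intro!: bounded_linear_imp_has_derivative bounded_linear_vec_nth)

lemma Ck_on_component: "Ck_on k UNIV (\<lambda>x::real^'n. x $ i)"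
  by (cases k) (auto intro!: Ck_on_SucI[OF GDERIV_component] Ck_on_const continuous_intros)

subsection \<open>A smooth bump function\<close>

text \<open>The functions s^(-m) exp(-1/s), extended by zero. Differentiation produces powers of 1/s
  but stays within the linear span of the family, so smoothness becomes an induction with
  \<open>m\<close> arbitrary.\<close>

definition flat_exp :: "nat \<Rightarrow> real \<Rightarrow> real" where
  "flat_exp m s = (if s > 0 then inverse s ^ m * exp (- inverse s) else 0)"

lemma flat_exp_nonneg: "flat_exp m s \<ge> 0"
  by (simp add: flat_exp_def)

lemma flat_exp_tendsto_0: "(flat_exp m \<longlongrightarrow> 0) (at 0)"
proof (rule filterlim_split_at)
  have "\<forall>\<^sub>F s in at_left 0. flat_exp m s = 0"
    by (auto simp: flat_exp_def eventually_at_filter)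
  then show "(flat_exp m \<longlongrightarrow> 0) (at_left 0)"
    by (rule tendsto_eventually)
  have "((\<lambda>s::real. inverse s ^ m / exp (inverse s)) \<longlongrightarrow> 0) (at_right 0)"
    by (rule filterlim_compose[OF tendsto_power_div_exp_0 filterlim_inverse_at_top_right])
  moreover have "\<forall>\<^sub>F s in at_right 0. inverse s ^ m / exp (inverse s) = flat_exp m s"
    by (auto simp: flat_exp_def eventually_at_filter exp_minus divide_inverse)
  ultimately show "(flat_exp m \<longlongrightarrow> 0) (at_right 0)"
    using tendsto_cong by fastforce
qed

lemma flat_exp_has_deriv:
  "(flat_exp m has_real_derivative flat_exp (m + 2) s - real m * flat_exp (m + 1) s) (at s)"
proof -
  consider "s < 0" | "s = 0" | "s > 0" by linarith
  then show ?thesis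
  proof cases
    case 1
    have "((\<lambda>_. 0) has_real_derivative 0) (at s)" by simp
    then have "(flat_exp m has_real_derivative 0) (at s)"
      by (rule has_field_derivative_transform_within_open[where S="{..<0}"])
        (use 1 in \<open>auto simp: flat_exp_def\<close>)
    then show ?thesis using 1 by (simp add: flat_exp_def)
  next
    case 2
    \<comment> \<open>At zero the difference quotient is itself a member of the family, with index
      one higher, so its limit is already known.\<close>
    have "(\<lambda>h. flat_exp m h / h) = flat_exp (m + 1)"
      by (auto simp: flat_exp_def fun_eq_iff divide_simps)
    then show ?thesis
      using 2 flat_exp_tendsto_0[of "m + 1"] by (simp add: DERIV_def flat_exp_def)
  next
    case 3
    have "((\<lambda>s. inverse s ^ m * exp (- inverse s)) has_real_derivative
        flat_exp (m + 2) s - real m * flat_exp (m + 1) s) (at s)"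
      using 3 by (auto intro!: derivative_eq_intros simp: flat_exp_def power2_eq_square algebra_simps)
        (cases m; simp add: algebra_simps)
    then show ?thesis
      by (rule has_field_derivative_transform_within_open[where S="{0<..}"])
        (use 3 in \<open>auto simp: flat_exp_def\<close>)
  qed
qed

lemma continuous_on_flat_exp: "continuous_on S (flat_exp m)"
  by (meson DERIV_isCont continuous_at_imp_continuous_on flat_exp_has_deriv)

lemma GDERIV_norm_sq: "GDERIV (\<lambda>x. (norm x)\<^sup>2) x :> 2 *\<^sub>R x"
  unfolding gderiv_def power2_norm_eq_inner
  by (auto intro!: derivative_eq_intros simp: inner_commute)

text \<open>\<open>c\<close> is a squared radius: composing with the squared norm keeps the function
  smooth at the origin.\<close>

definition bump :: "real \<Rightarrow> nat \<Rightarrow> real^'n \<Rightarrow> real" where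
  "bump c m x = flat_exp m (c - (norm x)\<^sup>2)"

lemma GDERIV_bump:
  fixes x :: "real^'n"
  shows "GDERIV (bump c m) x :> (bump c (m + 2) x - real m * bump c (m + 1) x) *\<^sub>R (- 2 *\<^sub>R x)"
proof -
  have "GDERIV (\<lambda>x. c - (norm x)\<^sup>2) x :> 0 - 2 *\<^sub>R x"
    by (rule GDERIV_diff[OF GDERIV_const GDERIV_norm_sq])
  from GDERIV_DERIV_compose[OF this flat_exp_has_deriv]
  show ?thesis unfolding bump_def by simp
qed

lemma Ck_on_bump: "Ck_on k UNIV (bump c m :: real^'n \<Rightarrow> real)"
proof (induction k arbitrary: m)
  case 0
  then show ?case
    using GDERIV_imp_continuous_on[OF GDERIV_bump] by simp
next
  case (Suc k)
  show ?case
  proof (rule Ck_on_SucI[OF GDERIV_bump])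
    fix i
    have "Ck_on k UNIV (\<lambda>x::real^'n. (bump c (m + 2) x + (- real m) * bump c (m + 1) x) * (- 2 * x $ i))"
      by (intro Ck_on_mult Ck_on_add Suc Ck_on_const Ck_on_component)
    then show "Ck_on k UNIV (\<lambda>x::real^'n. ((bump c (m + 2) x - real m * bump c (m + 1) x) *\<^sub>R (- 2 *\<^sub>R x)) $ i)"
      by (simp add: algebra_simps)
  qed
qed

subsection \<open>Integrals of compactly supported functions\<close>

lemma integrable_compact_support:
  fixes f :: "'a::euclidean_space \<Rightarrow> 'b::{banach, second_countable_topology}"
  assumes "continuous_on UNIV f" and "\<And>x. norm x \<ge> R \<Longrightarrow> f x = 0"
  shows "integrable lborel f"
proof -
  have "integrable lborel (\<lambda>x. indicator (cball 0 R) x *\<^sub>R f x)"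
    by (rule borel_integrable_compact) (auto intro: continuous_on_subset[OF assms(1)])
  moreover have "(\<lambda>x. indicator (cball 0 R) x *\<^sub>R f x) = f"
    using assms(2) by (auto simp: indicator_def fun_eq_iff)
  ultimately show ?thesis by simp
qed

lemma bounded_compact_support:
  fixes f :: "'a::euclidean_space \<Rightarrow> 'b::real_normed_vector"
  assumes "continuous_on UNIV f" and "\<And>x. norm x \<ge> R \<Longrightarrow> f x = 0"
  obtains M where "M > 0" "\<And>x. norm (f x) \<le> M"
proof -
  have "compact (f ` cball 0 R)"
    by (intro compact_continuous_image continuous_on_subset[OF assms(1)]) auto
  then obtain M where M: "M > 0" "\<And>x. x \<in> cball 0 R \<Longrightarrow> norm (f x) \<le> M"
    using compact_imp_bounded[of "f ` cball 0 R"] unfolding bounded_pos by auto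
  then have "norm (f x) \<le> M" for x
    using assms(2)[of x] by (cases "norm x \<le> R") auto
  then show ?thesis using M that by blast
qed

section \<open>Gradients of compactly supported functions\<close>

lemma GDERIV_unique:
  assumes "GDERIV f x :> D" "GDERIV f x :> D'"
  shows "D = D'"
proof -
  have "(\<lambda>h. h \<bullet> D) = (\<lambda>h. h \<bullet> D')"
    using assms unfolding gderiv_def by (rule has_derivative_unique)
  then have "\<forall>h. h \<bullet> D = h \<bullet> D'" by (simp add: fun_eq_iff)
  then show ?thesis by (rule vector_eq_ldot[THEN iffD1])
qed

lemma GDERIV_eq_0_on_open:
  assumes "GDERIV f x :> D" and "open S" "x \<in> S" "\<And>y. y \<in> S \<Longrightarrow> f y = 0"
  shows "D = 0"
proof -
  have "GDERIV f x :> 0"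
    unfolding gderiv_def
    by (rule has_derivative_transform_within_open[of "\<lambda>_. 0" _ _ _ S]) (use assms in auto)
  then show ?thesis using GDERIV_unique assms(1) by blast
qed

text \<open>The strict inequality provides an open set of zeros around \<open>x\<close>. Later
  applications enlarge a radius by one for this reason.\<close>

lemma GDERIV_compact_support:
  assumes "\<And>x. GDERIV f x :> g x" and "\<And>x. norm x \<ge> R \<Longrightarrow> f x = 0" and "norm x > R"
  shows "g x = 0"
proof -
  have "open {x. norm x > R}"
    by (intro open_Collect_less continuous_intros)
  then show ?thesis
    using GDERIV_eq_0_on_open[OF assms(1)[of x], of "{x. norm x > R}"] assms by force
qed

lemma GDERIV_has_line_derivative:
  assumes "\<And>x. GDERIV f x :> g x"
  shows "((\<lambda>s. f (x + s *\<^sub>R e)) has_real_derivative (e \<bullet> g (x + s *\<^sub>R e))) (at s)"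
proof -
  have "((\<lambda>s. f (x + s *\<^sub>R e)) has_derivative (\<lambda>h. (h *\<^sub>R e) \<bullet> g (x + s *\<^sub>R e))) (at s)"
    by (rule has_derivative_compose[OF _ assms[unfolded gderiv_def]])
      (auto intro!: derivative_eq_intros)
  then show ?thesis
    unfolding has_field_derivative_def by (rule has_derivative_eq_rhs) (simp add: fun_eq_iff)
qed

lemma integral_translation:
  fixes f :: "'a::euclidean_space \<Rightarrow> real"
  assumes "f \<in> borel_measurable borel"
  shows "(\<integral>x. f (c + x) \<partial>lborel) = (\<integral>x. f x \<partial>lborel)"
proof -
  have "(\<integral>x. f x \<partial>lborel) = (\<integral>x. f x \<partial>(distr lborel borel ((+) c)))"
    by (simp add: lborel_distr_plus)
  also have "\<dots> = (\<integral>x. f (c + x) \<partial>lborel)"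
    by (rule integral_distr) (use assms in auto)
  finally show ?thesis ..
qed

text \<open>The difference quotients of \<open>f\<close> have integral zero by translation invariance.\<close>

lemma integral_grad_eq_0:
  fixes f :: "'a::euclidean_space \<Rightarrow> real"
  assumes D: "\<And>x. GDERIV f x :> g x" and cg: "continuous_on UNIV g"
    and supp: "\<And>x. norm x \<ge> R \<Longrightarrow> f x = 0"
  shows "(\<integral>x. e \<bullet> g x \<partial>lborel) = 0"
proof -
  define h where "h k = inverse (real (Suc k))" for k
  define d where "d k x = (f (h k *\<^sub>R e + x) - f x) / h k" for k x
  have h: "0 < h k" "h k \<le> 1" for k by (auto simp: h_def divide_simps)
  have cf: "continuous_on UNIV f" using D GDERIV_imp_continuous_on by blast
  have [measurable]: "f \<in> borel_measurable borel" "g \<in> borel_measurable borel"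
    using cf cg by (auto intro: borel_measurable_continuous_onI)
  have "g x = 0" if "norm x \<ge> R + 1" for x
    using GDERIV_compact_support[OF D supp] that by auto
  then obtain M where M: "M > 0" "\<And>x. norm (g x) \<le> M"
    using bounded_compact_support[OF cg] by metis
  have fi: "integrable lborel f" by (rule integrable_compact_support[OF cf supp])
  have lim: "(\<lambda>k. d k x) \<longlonglongrightarrow> e \<bullet> g x" for x
  proof -
    have "((\<lambda>s. (f (x + s *\<^sub>R e) - f x) / s) \<longlongrightarrow> e \<bullet> g x) (at 0)"
      using GDERIV_has_line_derivative[OF D, where x=x and e=e and s=0] unfolding DERIV_def by simp
    moreover have "filterlim h (at 0) sequentially"
      unfolding filterlim_at using LIMSEQ_inverse_real_of_nat h(1)
      by (auto simp: h_def[abs_def] less_imp_neq[THEN not_sym])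
    ultimately have "(\<lambda>k. (f (x + h k *\<^sub>R e) - f x) / h k) \<longlonglongrightarrow> e \<bullet> g x"
      by (rule filterlim_compose)
    then show ?thesis by (simp add: d_def add.commute)
  qed
  \<comment> \<open>The mean value theorem bounds each quotient by \<open>norm e * M\<close>, and
    since \<open>h k \<le> 1\<close> all supports lie in one ball of radius
    \<open>R + norm e\<close>.\<close>
  have bnd: "norm (d k x) \<le> indicator (cball 0 (R + norm e)) x * (norm e * M)" for k x
  proof (cases "norm x \<le> R + norm e")
    case True
    obtain z where z: "f (x + h k *\<^sub>R e) - f (x + 0 *\<^sub>R e) = (h k - 0) * (e \<bullet> g (x + z *\<^sub>R e))"
      using MVT2[OF h(1)[of k], of "\<lambda>s. f (x + s *\<^sub>R e)" "\<lambda>s. e \<bullet> g (x + s *\<^sub>R e)"]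
        GDERIV_has_line_derivative[OF D, of x e] by blast
    then have "d k x = e \<bullet> g (x + z *\<^sub>R e)"
      using h(1)[of k] by (simp add: d_def add.commute divide_simps)
    also have "\<bar>\<dots>\<bar> \<le> norm e * M"
      by (rule order_trans[OF Cauchy_Schwarz_ineq2 mult_left_mono[OF M(2)]]) auto
    finally show ?thesis using True by simp
  next
    case False
    have "norm x \<le> norm (h k *\<^sub>R e + x) + norm (h k *\<^sub>R e)"
      using norm_triangle_ineq4[of "h k *\<^sub>R e + x" "h k *\<^sub>R e"] by simp
    also have "norm (h k *\<^sub>R e) \<le> 1 * norm e"
      using h[of k] by (simp add: mult_left_le_one_le)
    finally have "norm (h k *\<^sub>R e + x) \<ge> R" using False by simp
    moreover have "norm x \<ge> R" using False norm_ge_zero[of e] by linarith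
    ultimately show ?thesis using supp M by (simp add: d_def)
  qed
  have "(\<lambda>k. integral\<^sup>L lborel (d k)) \<longlonglongrightarrow> (\<integral>x. e \<bullet> g x \<partial>lborel)"
  proof (rule integral_dominated_convergence)
    show "integrable lborel (\<lambda>x::'a. indicator (cball 0 (R + norm e)) x * (norm e * M))"
      by (intro integrable_mult_left integrable_real_indicator)
        (auto simp: emeasure_bounded_finite[OF bounded_cball, unfolded infinity_ennreal_def])
  qed (use lim bnd in \<open>auto simp: d_def[abs_def]\<close>)
  moreover have "integral\<^sup>L lborel (d k) = 0" for k
  proof -
    have "integrable lborel (\<lambda>x. f (h k *\<^sub>R e + x))"
      using fi lborel_distr_plus[of "h k *\<^sub>R e"] integrable_distr[of "(+) (h k *\<^sub>R e)" lborel borel f]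
      by auto
    then show ?thesis
      unfolding d_def using fi integral_translation[of f "h k *\<^sub>R e"]
      by simp
  qed
  ultimately show ?thesis by (simp add: LIMSEQ_const_iff)
qed

subsection \<open>Mollification\<close>

text \<open>Vector values are allowed so that a whole gradient can be mollified at once.\<close>

definition conv :: "('a::euclidean_space \<Rightarrow> real) \<Rightarrow> ('a \<Rightarrow> 'b::euclidean_space) \<Rightarrow> 'a \<Rightarrow> 'b" where
  "conv K g x = (\<integral>y. K y *\<^sub>R g (x - y) \<partial>lborel)"

lemma integrable_conv:
  fixes K :: "'a::euclidean_space \<Rightarrow> real" and g :: "'a \<Rightarrow> 'b::euclidean_space"
  assumes "continuous_on UNIV K" "\<And>x. norm x \<ge> R \<Longrightarrow> K x = 0" "continuous_on UNIV g"
  shows "integrable lborel (\<lambda>y. K y *\<^sub>R g (x - y))"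
proof (rule integrable_compact_support)
  show "continuous_on UNIV (\<lambda>y. K y *\<^sub>R g (x - y))"
    by (intro continuous_on_scaleR assms(1) continuous_on_compose2[OF assms(3)] continuous_intros) auto
  show "K y *\<^sub>R g (x - y) = 0" if "norm y \<ge> R" for y
    using assms(2)[OF that] by simp
qed

text \<open>Bridge from the Lebesgue integral over the whole space to a gauge integral over a box,
  the form to which \<open>leibniz_rule\<close> applies.\<close>

lemma has_integral_conv:
  fixes K :: "'a::euclidean_space \<Rightarrow> real" and g :: "'a \<Rightarrow> 'b::euclidean_space"
  assumes K: "continuous_on UNIV K" "\<And>x. norm x \<ge> R \<Longrightarrow> K x = 0" and g: "continuous_on UNIV g"
    and "ball 0 R \<subseteq> cbox a b"
  shows "((\<lambda>y. K y *\<^sub>R g (x - y)) has_integral conv K g x) (cbox a b)"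
proof -
  have "((\<lambda>y. K y *\<^sub>R g (x - y)) has_integral conv K g x) UNIV"
    unfolding conv_def by (intro has_integral_integral_lborel integrable_conv[OF K g])
  then have "((\<lambda>y. if y \<in> cbox a b then K y *\<^sub>R g (x - y) else 0) has_integral conv K g x) UNIV"
    by (rule has_integral_eq[rotated]) (use K(2) assms(4) in \<open>force simp: subset_iff\<close>)
  then show ?thesis by (rule has_integral_restrict_UNIV[THEN iffD1])
qed

text \<open>Differentiation under the integral sign, with the derivative put on \<open>g\<close>;
  the kernel enters only through its continuity and its support.\<close>

lemma GDERIV_conv:
  fixes K :: "'a::euclidean_space \<Rightarrow> real"
  assumes K: "continuous_on UNIV K" "\<And>x. norm x \<ge> R \<Longrightarrow> K x = 0"
    and D: "\<And>x. GDERIV g x :> Dg x" and cDg: "continuous_on UNIV Dg"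
  shows "GDERIV (conv K g) x :> conv K Dg x"
proof -
  obtain a b :: 'a where ab: "ball 0 R \<subseteq> cbox a b"
    by (meson bounded_ball bounded_subset_cbox_symmetric)
  have cg: "continuous_on UNIV g" using D GDERIV_imp_continuous_on by blast
  \<comment> \<open>The derivative of the integrand, packed as a bounded linear functional as
    \<open>leibniz_rule\<close> expects it.\<close>
  define fx where "fx x y = K y *\<^sub>R blinfun_inner_left (Dg (x - y))" for x y
  have cfx: "continuous_on (UNIV \<times> cbox a b) (\<lambda>(x, y). fx x y)"
    unfolding fx_def case_prod_beta
    by (intro continuous_intros continuous_on_compose2[OF K(1)]
        bounded_linear.continuous_on[OF bounded_linear_blinfun_inner_left]
        continuous_on_compose2[OF cDg]) auto
  have D1: "((\<lambda>x. K y *\<^sub>R g (x - y)) has_derivative blinfun_apply (fx x y)) (at x within UNIV)" for x y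
  proof -
    have "((\<lambda>x. g (x - y)) has_derivative (\<lambda>h. h \<bullet> Dg (x - y))) (at x)"
      by (rule has_derivative_compose[OF _ D[unfolded gderiv_def]])
        (auto intro!: derivative_eq_intros)
    then show ?thesis
      by (auto simp: fx_def blinfun.scaleR_left intro!: derivative_eq_intros)
  qed
  have hi: "((\<lambda>y. K y *\<^sub>R g (x - y)) has_integral conv K g x) (cbox a b)" for x
    by (rule has_integral_conv[OF K cg ab])
  have "((\<lambda>x. integral (cbox a b) (\<lambda>y. K y *\<^sub>R g (x - y))) has_derivative
      blinfun_apply (integral (cbox a b) (fx x))) (at x within UNIV)"
    by (rule leibniz_rule[OF D1 _ cfx]) (use hi in auto)
  moreover have "blinfun_apply (integral (cbox a b) (fx x)) h = h \<bullet> conv K Dg x" for h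
  proof -
    have "continuous_on (cbox a b) (fx x)"
      using continuous_on_compose2[OF cfx, of "cbox a b" "\<lambda>y. (x, y)"]
      by (simp add: image_subset_iff continuous_on_Pair)
    then have "fx x integrable_on cbox a b" by (rule integrable_continuous)
    then have "blinfun_apply (integral (cbox a b) (fx x)) h = integral (cbox a b) (\<lambda>y. fx x y h)"
      by (rule blinfun_apply_integral)
    also have "\<dots> = integral (cbox a b) (\<lambda>y. h \<bullet> (K y *\<^sub>R Dg (x - y)))"
      by (simp add: fx_def blinfun.scaleR_left)
    also have "\<dots> = h \<bullet> conv K Dg x"
      using has_integral_linear[OF has_integral_conv[OF K cDg ab] bounded_linear_inner_right]
      by (intro integral_unique) (simp add: o_def)
    finally show ?thesis .
  qed
  then have "blinfun_apply (integral (cbox a b) (fx x)) = (\<lambda>h. h \<bullet> conv K Dg x)" by blast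
  moreover have "(\<lambda>x. integral (cbox a b) (\<lambda>y. K y *\<^sub>R g (x - y))) = conv K g"
    using hi integral_unique by blast
  ultimately show ?thesis
    unfolding gderiv_def by simp
qed

lemma conv_nth:
  fixes g :: "real^'n \<Rightarrow> real^'n"
  assumes "continuous_on UNIV K" "\<And>x. norm x \<ge> R \<Longrightarrow> K x = 0" "continuous_on UNIV g"
  shows "conv K g x $ i = conv K (\<lambda>x. g x $ i) x"
proof -
  have "(\<integral>y. (K y *\<^sub>R g (x - y)) \<bullet> axis i 1 \<partial>lborel) = (\<integral>y. K y *\<^sub>R g (x - y) \<partial>lborel) \<bullet> axis i 1"
    by (rule integral_inner_left) (rule integrable_conv[OF assms])
  then show ?thesis by (simp add: conv_def inner_axis)
qed

text \<open>The reflection sending y to x - y preserves Lebesgue measure. The symmetry allows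
  derivatives to be moved from one factor to the other.\<close>

lemma conv_commute:
  fixes K g :: "'a::euclidean_space \<Rightarrow> real"
  assumes [measurable]: "K \<in> borel_measurable borel" "g \<in> borel_measurable borel"
  shows "conv K g x = conv g K x"
proof -
  have "conv K g x = (\<integral>y. K y * g (x - y) \<partial>(distr lborel borel (\<lambda>y. x + (-1) *\<^sub>R y)))"
    unfolding conv_def by (subst lborel_affine[of "-1" x]) (auto simp: density_1)
  also have "\<dots> = (\<integral>y. K (x - y) * g y \<partial>lborel)"
    by (subst integral_distr) auto
  finally show ?thesis by (simp add: conv_def mult.commute)
qed

text \<open>All derivatives fall on \<open>g\<close>. In the application \<open>g\<close> is the
  smooth kernel and \<open>K\<close> the function to be mollified, their roles being exchanged by
  \<open>conv_commute\<close>. Smoothness of every order is assumed so that the base case, too, can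
  obtain continuity from a derivative.\<close>

lemma Ck_on_conv:
  fixes K g :: "real^'n \<Rightarrow> real"
  assumes K: "continuous_on UNIV K" "\<And>x. norm x \<ge> R \<Longrightarrow> K x = 0"
  shows "(\<And>k. Ck_on k UNIV g) \<Longrightarrow> Ck_on k UNIV (conv K g)"
proof (induction k arbitrary: g)
  case (0 g)
  have "GDERIV (conv K g) x :> conv K (grad g) x" for x
  proof (rule GDERIV_conv[OF K])
    show "GDERIV g x :> grad g x" for x
      using Ck_on_SucD(1)[OF 0] by blast
    show "continuous_on UNIV (grad g)"
      by (rule continuous_on_vecI) (rule Ck_on_imp_continuous_on[OF Ck_on_SucD(2)[OF 0]])
  qed
  then have "continuous_on UNIV (conv K g)" by (rule GDERIV_imp_continuous_on)
  then show ?case by simp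
next
  case (Suc k g)
  have c: "continuous_on UNIV (grad g)"
    by (rule continuous_on_vecI) (rule Ck_on_imp_continuous_on[OF Ck_on_SucD(2)[OF Suc.prems]])
  show ?case
  proof (rule Ck_on_SucI)
    show "GDERIV (conv K g) x :> conv K (grad g) x" for x
      using Ck_on_SucD(1)[OF Suc.prems] by (intro GDERIV_conv[OF K _ c]) auto
    show "Ck_on k UNIV (\<lambda>x. conv K (grad g) x $ i)" for i
    proof -
      have "(\<lambda>x. conv K (grad g) x $ i) = conv K (\<lambda>x. grad g x $ i)"
        by (intro ext conv_nth[OF K c])
      then show ?thesis using Suc.IH[OF Ck_on_SucD(2)[OF Suc.prems]] by simp
    qed
  qed
qed

text \<open>As \<open>K\<close> is nonnegative with mass one, the difference is an average of
  \<open>g (x - y) - g x\<close> over the ball of radius \<open>\<delta>\<close>.\<close>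

lemma norm_conv_diff_le:
  fixes K :: "'a::euclidean_space \<Rightarrow> real" and g :: "'a \<Rightarrow> 'b::euclidean_space"
  assumes K: "continuous_on UNIV K" "\<And>x. norm x \<ge> \<delta> \<Longrightarrow> K x = 0" "\<And>x. K x \<ge> 0"
    "(\<integral>x. K x \<partial>lborel) = 1" and g: "continuous_on UNIV g"
    and eps: "\<And>y. norm y < \<delta> \<Longrightarrow> norm (g (x - y) - g x) \<le> \<epsilon>"
  shows "norm (conv K g x - g x) \<le> \<epsilon>"
proof -
  have Ki: "integrable lborel K" by (rule integrable_compact_support[OF K(1,2)])
  have i: "integrable lborel (\<lambda>y. K y *\<^sub>R (g (x - y) - g x))"
    unfolding scaleR_diff_right
    by (intro Bochner_Integration.integrable_diff integrable_conv[OF K(1,2) g]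
        integrable_scaleR_left Ki)
  have "conv K g x - g x = (\<integral>y. K y *\<^sub>R (g (x - y) - g x) \<partial>lborel)"
    using Ki K(4) integrable_conv[OF K(1,2) g, where x=x] by (simp add: conv_def scaleR_diff_right)
  also have "norm \<dots> \<le> (\<integral>y. norm (K y *\<^sub>R (g (x - y) - g x)) \<partial>lborel)"
    by (rule integral_norm_bound)
  also have "\<dots> \<le> (\<integral>y. K y * \<epsilon> \<partial>lborel)"
  proof (rule integral_mono)
    show "integrable lborel (\<lambda>y. norm (K y *\<^sub>R (g (x - y) - g x)))"
      by (rule integrable_norm[OF i])
    show "norm (K y *\<^sub>R (g (x - y) - g x)) \<le> K y * \<epsilon>" for y
      using K(2)[of y] K(3)[of y] eps[of y] by (cases "norm y < \<delta>") (auto intro: mult_left_mono)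
  qed (use Ki in simp)
  finally show ?thesis using K(4) by simp
qed

lemma uniform_modulus_compact_support:
  fixes g :: "'a::euclidean_space \<Rightarrow> 'b::real_normed_vector"
  assumes g: "continuous_on UNIV g" "\<And>x. norm x \<ge> R \<Longrightarrow> g x = 0" and "\<epsilon> > 0"
  obtains \<delta> where "0 < \<delta>" "\<delta> \<le> 1" "\<And>x y. norm y < \<delta> \<Longrightarrow> norm (g (x - y) - g x) \<le> \<epsilon>"
proof -
  \<comment> \<open>The margin of 2 keeps \<open>x\<close> and \<open>x - y\<close> in the compact
    ball when \<open>norm x \<le> R + 1\<close> and \<open>norm y < 1\<close>; for larger
    \<open>x\<close> both values vanish.\<close>
  have "uniformly_continuous_on (cball 0 (R + 2)) g"
    by (intro compact_uniformly_continuous continuous_on_subset[OF g(1)]) auto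
  then obtain d where d: "d > 0"
    "\<And>x x'. x \<in> cball 0 (R + 2) \<Longrightarrow> x' \<in> cball 0 (R + 2) \<Longrightarrow> dist x' x < d \<Longrightarrow> dist (g x') (g x) < \<epsilon>"
    using \<open>\<epsilon> > 0\<close> unfolding uniformly_continuous_on_def by metis
  have "norm (g (x - y) - g x) \<le> \<epsilon>" if y: "norm y < min d 1" for x y
  proof (cases "norm x \<le> R + 1")
    case True
    then have "norm (x - y) \<le> R + 2" using norm_triangle_ineq4[of x y] y by linarith
    then have "x - y \<in> cball 0 (R + 2)" "x \<in> cball 0 (R + 2)" using True by (simp_all add: mem_cball_0)
    from d(2)[OF this(2,1)] show ?thesis using y by (simp add: dist_norm)
  next
    case False
    then have "norm (x - y) \<ge> R" using norm_triangle_ineq2[of x y] y by linarith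
    then show ?thesis using g(2) False \<open>\<epsilon> > 0\<close> by simp
  qed
  then show ?thesis using that[of "min d 1"] d by auto
qed

section \<open>Approximation of C^1 functions by test functions\<close>

lemma bump_eq_0:
  assumes "0 \<le> \<delta>" "\<delta> \<le> norm x"
  shows "bump (\<delta>\<^sup>2) m x = 0"
proof -
  have "\<delta>\<^sup>2 \<le> (norm x)\<^sup>2" using assms by (intro power_mono)
  then show ?thesis by (simp add: bump_def flat_exp_def)
qed

text \<open>The bump is positive on a ball of positive volume; this permits its normalisation to a
  kernel of mass one.\<close>

lemma bump_integral_pos:
  assumes "\<delta> > 0"
  shows "(\<integral>x. bump (\<delta>\<^sup>2) 0 (x::real^'n) \<partial>lborel) > 0"
proof -
  let ?b = "bump (\<delta>\<^sup>2) 0 :: real^'n \<Rightarrow> real"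
  have z: "?b x = 0" if "norm x \<ge> \<delta>" for x
    using that assms by (intro bump_eq_0) auto
  have pos: "?b x > 0" if "x \<in> ball 0 \<delta>" for x
    using that assms power_strict_mono[of "norm x" \<delta> 2] by (simp add: bump_def flat_exp_def)
  have c: "continuous_on UNIV ?b" using Ck_on_bump[of 0] by simp
  have i: "integrable lborel ?b" by (rule integrable_compact_support[OF c z])
  have nn: "?b x \<ge> 0" for x by (simp add: bump_def flat_exp_nonneg)
  have "(\<integral>x. ?b x \<partial>lborel) \<noteq> 0"
  proof
    assume "(\<integral>x. ?b x \<partial>lborel) = 0"
    then have "AE x in lborel. ?b x = 0"
      using integral_nonneg_eq_0_iff_AE[OF i] nn by simp
    then have "AE x in lborel. x \<notin> ball (0::real^'n) \<delta>"
      by (rule AE_mp) (use pos in \<open>force intro!: AE_I2\<close>)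
    then have "emeasure lborel (ball (0::real^'n) \<delta>) = 0"
      by (subst (asm) AE_iff_null_sets[symmetric]) auto
    moreover have "unit_ball_vol (real CARD('n)) * \<delta> ^ CARD('n) > 0"
      using assms unit_ball_vol_pos by (intro mult_pos_pos) auto
    ultimately show False
      using emeasure_ball[of \<delta> "0::real^'n"] assms by (simp add: ennreal_eq_0_iff)
  qed
  moreover have "(\<integral>x. ?b x \<partial>lborel) \<ge> 0" using nn by simp
  ultimately show ?thesis by simp
qed

text \<open>The gradient of a mollified C^1 function is the mollified gradient, so one mollification
  approximates both uniformly.\<close>

lemma C1_approx_by_test_function:
  fixes v :: "real^'n \<Rightarrow> real"
  assumes D: "\<And>x. GDERIV v x :> Dv x" and cDv: "continuous_on UNIV Dv"
    and supp: "\<And>x. norm x \<ge> R \<Longrightarrow> v x = 0" and "\<epsilon> > 0"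
  obtains \<phi> where "test_function \<phi>" "\<And>x. \<bar>\<phi> x - v x\<bar> \<le> \<epsilon>"
    "\<And>x. norm (grad \<phi> x - Dv x) \<le> \<epsilon>" "\<And>x. norm x \<ge> R + 1 \<Longrightarrow> \<phi> x = 0"
proof -
  have cv: "continuous_on UNIV v" using D GDERIV_imp_continuous_on by blast
  obtain \<delta>1 where 1: "0 < \<delta>1" "\<delta>1 \<le> 1" "\<And>x y. norm y < \<delta>1 \<Longrightarrow> norm (v (x - y) - v x) \<le> \<epsilon>"
    using uniform_modulus_compact_support[OF cv supp \<open>\<epsilon> > 0\<close>] by metis
  have "Dv x = 0" if "norm x \<ge> R + 1" for x
    using GDERIV_compact_support[OF D supp] that by auto
  then obtain \<delta>2 where 2: "0 < \<delta>2" "\<And>x y. norm y < \<delta>2 \<Longrightarrow> norm (Dv (x - y) - Dv x) \<le> \<epsilon>"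
    using uniform_modulus_compact_support[OF cDv _ \<open>\<epsilon> > 0\<close>] by metis
  \<comment> \<open>One radius for the moduli of \<open>v\<close> and of \<open>Dv\<close>; the
    bound by 1 inherited from \<open>\<delta>1\<close> keeps the support of the result within radius
    \<open>R + 1\<close>.\<close>
  define \<delta> where "\<delta> = min \<delta>1 \<delta>2"
  have \<delta>: "0 < \<delta>" "\<delta> \<le> 1" "\<delta> \<le> \<delta>1" "\<delta> \<le> \<delta>2" using 1 2 by (auto simp: \<delta>_def)
  define c where "c = (\<integral>x. bump (\<delta>\<^sup>2) 0 (x::real^'n) \<partial>lborel)"
  have "c > 0" unfolding c_def by (rule bump_integral_pos[OF \<delta>(1)])
  define K :: "real^'n \<Rightarrow> real" where "K = (\<lambda>x. inverse c * bump (\<delta>\<^sup>2) 0 x)"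
  have smooth: "Ck_on k UNIV K" for k
    unfolding K_def by (intro Ck_on_mult Ck_on_const Ck_on_bump)
  have cK: "continuous_on UNIV K" using smooth[of 0] by simp
  have K0: "K x = 0" if "norm x \<ge> \<delta>" for x
    using that \<delta>(1) by (simp add: K_def bump_eq_0)
  have Knn: "K x \<ge> 0" for x using \<open>c > 0\<close> by (simp add: K_def bump_def flat_exp_nonneg)
  have K1: "(\<integral>x. K x \<partial>lborel) = 1" using \<open>c > 0\<close> by (simp add: K_def c_def[symmetric])
  define \<phi> where "\<phi> = conv K v"
  have Dphi: "GDERIV \<phi> x :> conv K Dv x" for x
    unfolding \<phi>_def by (rule GDERIV_conv[OF cK K0 D cDv])
  have z: "\<phi> x = 0" if x: "norm x \<ge> R + 1" for x
  proof -
    have "K y *\<^sub>R v (x - y) = 0" for y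
    proof (cases "norm y < \<delta>")
      case True
      then have "norm (x - y) \<ge> R" using norm_triangle_ineq2[of x y] x \<delta> by linarith
      then show ?thesis using supp by simp
    qed (use K0 in auto)
    then show ?thesis unfolding \<phi>_def conv_def by (simp only: integral_zero)
  qed
  \<comment> \<open>Exchanging the factors puts the derivatives on the smooth kernel,
    \<open>v\<close> itself being merely C^1.\<close>
  have "\<phi> = conv v K"
    unfolding \<phi>_def
    by (intro ext conv_commute borel_measurable_continuous_onI cK cv)
  then have "Ck_on k UNIV \<phi>" for k
    using Ck_on_conv[OF cv supp smooth] by simp
  moreover have "compact (closure {x. \<phi> x \<noteq> 0})"
  proof -
    have "{x. \<phi> x \<noteq> 0} \<subseteq> cball 0 (R + 1)" using z by force
    then show ?thesis using bounded_subset bounded_cball compact_closure by blast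
  qed
  ultimately have "test_function \<phi>" by (simp add: test_function_def)
  moreover have "\<bar>\<phi> x - v x\<bar> \<le> \<epsilon>" for x
    using norm_conv_diff_le[OF cK K0 Knn K1 cv, where x=x and \<epsilon>=\<epsilon>] 1(3) \<delta>(3) unfolding \<phi>_def by auto
  moreover have "norm (grad \<phi> x - Dv x) \<le> \<epsilon>" for x
    using norm_conv_diff_le[OF cK K0 Knn K1 cDv, where x=x and \<epsilon>=\<epsilon>] 2(2) \<delta>(4) GDERIV_imp_grad[OF Dphi[of x]]
    by auto
  ultimately show ?thesis using that z by blast
qed

subsection \<open>Cutoffs away from the origin and from infinity\<close>

text \<open>The standard smooth step built from exp(-1/s): it descends from 1 to 0 on the interval
  [1, 2].\<close>

definition transition :: "real \<Rightarrow> real" where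
  "transition s = flat_exp 0 (2 - s) / (flat_exp 0 (2 - s) + flat_exp 0 (s - 1))"

text \<open>The arguments \<open>2 - s\<close> and \<open>s - 1\<close> cannot both be
  nonpositive.\<close>

lemma transition_denominator_pos: "flat_exp 0 (2 - s) + flat_exp 0 (s - 1) > 0"
  by (cases "s < 2") (auto simp: flat_exp_def add_pos_nonneg)

lemma transition_range: "0 \<le> transition s" "transition s \<le> 1"
  using transition_denominator_pos[of s] flat_exp_nonneg
  by (auto simp: transition_def divide_simps)

lemma transition_eq_1: "s \<le> 1 \<Longrightarrow> transition s = 1"
  using transition_denominator_pos[of s] by (auto simp: transition_def flat_exp_def split: if_splits)

lemma transition_eq_0: "s \<ge> 2 \<Longrightarrow> transition s = 0"
  by (auto simp: transition_def flat_exp_def)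

lemma transition_has_deriv:
  obtains d M where "\<And>s. (transition has_real_derivative d s) (at s)" "continuous_on UNIV d"
    "M > 0" "\<And>s. \<bar>d s\<bar> \<le> M" "\<And>s. s < 1 \<or> 2 < s \<Longrightarrow> d s = 0"
proof -
  define d where "d s = (- flat_exp 2 (2 - s) * (flat_exp 0 (2 - s) + flat_exp 0 (s - 1))
      - flat_exp 0 (2 - s) * (- flat_exp 2 (2 - s) + flat_exp 2 (s - 1)))
      / ((flat_exp 0 (2 - s) + flat_exp 0 (s - 1)) * (flat_exp 0 (2 - s) + flat_exp 0 (s - 1)))" for s
  have e: "(flat_exp 0 has_real_derivative flat_exp 2 s) (at s)" for s
    using flat_exp_has_deriv[of 0 s] by (simp add: numeral_2_eq_2)
  have 1: "((\<lambda>s. flat_exp 0 (2 - s)) has_real_derivative - flat_exp 2 (2 - s)) (at s)" for s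
  proof -
    have "((\<lambda>s. 2 - s) has_real_derivative -1) (at s)" by (auto intro!: derivative_eq_intros)
    from DERIV_chain2[OF e this] show ?thesis by simp
  qed
  have 2: "((\<lambda>s. flat_exp 0 (s - 1)) has_real_derivative flat_exp 2 (s - 1)) (at s)" for s
  proof -
    have "((\<lambda>s. s - 1) has_real_derivative 1) (at s)" by (auto intro!: derivative_eq_intros)
    from DERIV_chain2[OF e this] show ?thesis by simp
  qed
  have D: "(transition has_real_derivative d s) (at s)" for s
    unfolding transition_def[abs_def] d_def
    by (rule DERIV_divide[OF 1 DERIV_add[OF 1 2]])
      (use transition_denominator_pos[of s] in simp)
  have c: "continuous_on UNIV d"
    unfolding d_def
    by (intro continuous_intros continuous_on_compose2[OF continuous_on_flat_exp[of UNIV]])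
      (use transition_denominator_pos in \<open>auto simp: less_imp_neq[THEN not_sym]\<close>)
  have z: "d s = 0" if "s < 1 \<or> 2 < s" for s
  proof -
    have "(transition has_real_derivative 0) (at s)"
      using that
    proof
      assume "s < 1"
      then show ?thesis
        using has_field_derivative_transform_within_open[of "\<lambda>_. 1" 0 s "{..<1}" transition]
        by (simp add: transition_eq_1)
    next
      assume "2 < s"
      then show ?thesis
        using has_field_derivative_transform_within_open[of "\<lambda>_. 0" 0 s "{2<..}" transition]
        by (simp add: transition_eq_0)
    qed
    then show ?thesis using D DERIV_unique by blast
  qed
  \<comment> \<open>Vanishing outside [1, 2] turns the continuity of \<open>d\<close> into a
    bound.\<close>
  have "d s = 0" if "norm s \<ge> 3" for s
    using that by (intro z) auto
  then obtain M where "M > 0" "\<And>s. norm (d s) \<le> M"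
    using bounded_compact_support[OF c] by metis
  then show ?thesis using that[OF D c _ _ z] by simp
qed

text \<open>With c = k + 1, the left factor falls from 1 to 0 while \<open>norm x\<close> runs from
  c to sqrt 2 c, and the right factor rises from 0 to 1 while it runs from 1 / c to sqrt 2 / c.
  Squared norms keep both factors smooth at the origin.\<close>

definition cutoff :: "nat \<Rightarrow> real^'n \<Rightarrow> real" where
  "cutoff k x = transition ((norm x)\<^sup>2 / (real (Suc k))\<^sup>2) * (1 - transition ((real (Suc k))\<^sup>2 * (norm x)\<^sup>2))"

lemma cutoff_range: "0 \<le> cutoff k x" "cutoff k x \<le> 1"
  unfolding cutoff_def using transition_range by (auto intro: mult_le_one)

lemma cutoff_eq_0_far: "norm x \<ge> 2 * real (Suc k) \<Longrightarrow> cutoff k x = 0"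
proof -
  assume "norm x \<ge> 2 * real (Suc k)"
  then have "(norm x)\<^sup>2 \<ge> (2 * real (Suc k))\<^sup>2" by (intro power_mono) auto
  then have "4 * (real (Suc k))\<^sup>2 \<le> (norm x)\<^sup>2"
    by (simp add: power_mult_distrib del: of_nat_Suc)
  then have "(norm x)\<^sup>2 / (real (Suc k))\<^sup>2 \<ge> 4"
    by (simp add: pos_le_divide_eq del: of_nat_Suc)
  then show ?thesis by (simp add: cutoff_def transition_eq_0)
qed

lemma cutoff_eq_0_near: "norm x \<le> 1 / real (Suc k) \<Longrightarrow> cutoff k x = 0"
proof -
  assume "norm x \<le> 1 / real (Suc k)"
  then have "(real (Suc k) * norm x)\<^sup>2 \<le> 1\<^sup>2"
    by (intro power_mono) (auto simp: divide_simps mult.commute)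
  then show ?thesis by (simp add: cutoff_def transition_eq_1 power_mult_distrib)
qed

lemma cutoff_eventually_1:
  assumes "x \<noteq> 0"
  shows "\<forall>\<^sub>F k in sequentially. cutoff k x = 1"
proof -
  \<comment> \<open>The first bound puts \<open>x\<close> inside the outer transition, the second
    beyond the inner one; 2 replaces sqrt 2 to avoid the root.\<close>
  obtain N where N: "real N > norm x" "real N > 2 / norm x"
    using reals_Archimedean2[of "max (norm x) (2 / norm x)"] by auto
  have "cutoff k x = 1" if "k \<ge> N" for k
  proof -
    let ?c = "real (Suc k)"
    have c: "?c > norm x" "?c > 2 / norm x" using that N by linarith+
    have "(norm x)\<^sup>2 / ?c\<^sup>2 \<le> 1"
      using c(1) power_mono[of "norm x" ?c 2] by (simp add: divide_simps)
    moreover have "2\<^sup>2 \<le> (?c * norm x)\<^sup>2"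
      using c(2) assms by (intro power_mono) (auto simp: divide_simps)
    ultimately show ?thesis
      by (simp add: cutoff_def transition_eq_1 transition_eq_0 power_mult_distrib)
  qed
  then show ?thesis unfolding eventually_sequentially by blast
qed

lemma cutoff_tendsto_1: "x \<noteq> 0 \<Longrightarrow> (\<lambda>k. cutoff k x) \<longlonglongrightarrow> 1"
  by (rule tendsto_eventually[OF cutoff_eventually_1])

text \<open>By the chain rule the gradient has size c = k + 1 near the origin and 1 / c far out,
  with one constant for all \<open>k\<close>. Each size is, up to a factor, the reciprocal of the
  radius of its region, so the integral of the n-th power is bounded uniformly in
  \<open>k\<close>.\<close>

lemma cutoff_C1:
  obtains M where "\<And>k x. GDERIV (cutoff k) x :> grad (cutoff k) (x::real^'n)"
    "\<And>k. continuous_on UNIV (grad (cutoff k :: real^'n \<Rightarrow> real))" "M > 0"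
    "\<And>k x::real^'n. norm (grad (cutoff k) x) \<le>
       M * (real (Suc k) * indicator (ball 0 (2 / real (Suc k))) x
         + inverse (real (Suc k)) * indicator (ball 0 (2 * real (Suc k)) - ball 0 (real (Suc k))) x)"
proof -
  obtain d M where d: "\<And>s. (transition has_real_derivative d s) (at s)" "continuous_on UNIV d"
    "M > 0" "\<And>s. \<bar>d s\<bar> \<le> M" "\<And>s. s < 1 \<or> 2 < s \<Longrightarrow> d s = 0"
    using transition_has_deriv by blast
  \<comment> \<open>\<open>a\<close> is the gradient of the factor that cuts off at infinity,
    \<open>b\<close> that of the factor that cuts off at the origin.\<close>
  define a where "a k x = (d ((norm x)\<^sup>2 / (real (Suc k))\<^sup>2) * 2 / (real (Suc k))\<^sup>2) *\<^sub>R x" for k and x::"real^'n"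
  define b where "b k x = - (d ((real (Suc k))\<^sup>2 * (norm x)\<^sup>2) * 2 * (real (Suc k))\<^sup>2) *\<^sub>R x" for k and x::"real^'n"
  define g where "g k x = transition ((norm x)\<^sup>2 / (real (Suc k))\<^sup>2) *\<^sub>R b k x
      + (1 - transition ((real (Suc k))\<^sup>2 * (norm x)\<^sup>2)) *\<^sub>R a k x" for k x
  have G: "GDERIV (cutoff k) x :> g k x" for k and x :: "real^'n"
  proof -
    let ?c = "real (Suc k)"
    have "GDERIV (\<lambda>x::real^'n. (norm x)\<^sup>2 / ?c\<^sup>2) x :> (1 / ?c\<^sup>2) *\<^sub>R 2 *\<^sub>R x"
      by (rule GDERIV_DERIV_compose[OF GDERIV_norm_sq DERIV_cdivide[OF DERIV_ident]])
    from GDERIV_DERIV_compose[OF this d(1)]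
    have 1: "GDERIV (\<lambda>x. transition ((norm x)\<^sup>2 / ?c\<^sup>2)) x :> a k x"
      by (simp add: a_def)
    have "GDERIV (\<lambda>x::real^'n. ?c\<^sup>2 * (norm x)\<^sup>2) x :> ?c\<^sup>2 *\<^sub>R 2 *\<^sub>R x"
      by (rule GDERIV_DERIV_compose[OF GDERIV_norm_sq]) (auto intro!: derivative_eq_intros)
    from GDERIV_diff[OF GDERIV_const GDERIV_DERIV_compose[OF this d(1)], of 1]
    have 2: "GDERIV (\<lambda>x. 1 - transition (?c\<^sup>2 * (norm x)\<^sup>2)) x :> b k x"
      by (simp add: b_def mult_ac)
    show ?thesis unfolding cutoff_def[abs_def] g_def by (rule GDERIV_mult[OF 1 2])
  qed
  have gg: "grad (cutoff k) = g k" for k using GDERIV_imp_grad[OF G] by blast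
  have ct: "continuous_on UNIV transition"
    using d(1) DERIV_isCont continuous_at_imp_continuous_on by blast
  have cg: "continuous_on UNIV (g k)" for k
    unfolding g_def a_def b_def
    by (intro continuous_intros continuous_on_compose2[OF d(2)] continuous_on_compose2[OF ct]) auto
  have na: "norm (a k x) \<le> 4 * M * (inverse (real (Suc k))
      * indicator (ball 0 (2 * real (Suc k)) - ball 0 (real (Suc k))) x)" for k x
  proof (cases "(norm x)\<^sup>2 / (real (Suc k))\<^sup>2 < 1 \<or> 2 < (norm x)\<^sup>2 / (real (Suc k))\<^sup>2")
    case True
    then show ?thesis using d(3,5) by (simp add: a_def indicator_def)
  next
    case False
    let ?c = "real (Suc k)"
    have c: "?c > 0" by simp
    \<comment> \<open>Where \<open>d\<close> does not vanish, \<open>norm x\<close> lies between c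
      and sqrt 2 c; the cruder upper bound \<open>2 * ?c\<close> is used below.\<close>
    have "?c\<^sup>2 \<le> (norm x)\<^sup>2" "(norm x)\<^sup>2 \<le> 2 * ?c\<^sup>2"
      using False c by (auto simp: not_less divide_simps split: if_splits)
    moreover have "2 * ?c\<^sup>2 < (2 * ?c)\<^sup>2" by (simp add: power_mult_distrib del: of_nat_Suc)
    ultimately have *: "?c \<le> norm x" "norm x < 2 * ?c"
      using power2_le_imp_le[of ?c "norm x"] power2_less_imp_less[of "norm x" "2 * ?c"] by auto
    have "norm (a k x) = \<bar>d ((norm x)\<^sup>2 / ?c\<^sup>2)\<bar> * (2 / ?c\<^sup>2 * norm x)"
      by (simp add: a_def abs_mult)
    also have "\<dots> \<le> M * (2 / ?c\<^sup>2 * (2 * ?c))"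
      using * d(3) by (intro mult_mono d(4)) auto
    also have "\<dots> = 4 * M * inverse ?c" by (simp add: power2_eq_square field_simps del: of_nat_Suc)
    finally show ?thesis using * by simp
  qed
  have nb: "norm (b k x) \<le> 4 * M * (real (Suc k) * indicator (ball 0 (2 / real (Suc k))) x)" for k x
  proof (cases "2 < (real (Suc k))\<^sup>2 * (norm x)\<^sup>2")
    case True
    then show ?thesis using d(3,5) by (simp add: b_def indicator_def)
  next
    case False
    let ?c = "real (Suc k)"
    have "(?c * norm x)\<^sup>2 < 2\<^sup>2" using False by (simp add: power_mult_distrib)
    then have "?c * norm x < 2" by (rule power2_less_imp_less) simp
    then have *: "norm x < 2 / ?c" by (simp add: field_simps del: of_nat_Suc)
    have "norm (b k x) = \<bar>d (?c\<^sup>2 * (norm x)\<^sup>2)\<bar> * (2 * ?c\<^sup>2 * norm x)"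
      by (simp add: b_def abs_mult)
    also have "\<dots> \<le> M * (2 * ?c\<^sup>2 * (2 / ?c))"
      using * d(3) by (intro mult_mono d(4)) auto
    also have "\<dots> = 4 * M * ?c" by (simp add: power2_eq_square del: of_nat_Suc)
    finally show ?thesis using * by simp
  qed
  have "norm (g k x) \<le> norm (b k x) + norm (a k x)" for k x
    unfolding g_def using transition_range
    by (intro order_trans[OF norm_triangle_ineq] add_mono)
      (auto intro!: mult_left_le_one_le)
  then have "norm (g k x) \<le> 4 * M * (real (Suc k) * indicator (ball 0 (2 / real (Suc k))) x
         + inverse (real (Suc k)) * indicator (ball 0 (2 * real (Suc k)) - ball 0 (real (Suc k))) x)" for k x
    using na[of k x] nb[of k x] unfolding distrib_left by (meson add_mono order_trans)
  then show ?thesis using that[of "4 * M"] G cg d(3) unfolding gg by simp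
qed

lemma GDERIV_cutoff: "GDERIV (cutoff k) x :> grad (cutoff k) (x::real^'n)"
  by (rule cutoff_C1) blast

lemma continuous_on_grad_cutoff: "continuous_on UNIV (grad (cutoff k :: real^'n \<Rightarrow> real))"
  by (rule cutoff_C1) blast

lemma continuous_on_cutoff: "continuous_on S (cutoff k)"
  by (rule GDERIV_imp_continuous_on[OF GDERIV_cutoff])

lemma grad_cutoff_near: "norm x < 1 / real (Suc k) \<Longrightarrow> grad (cutoff k) x = 0"
  by (rule GDERIV_eq_0_on_open[OF GDERIV_cutoff, where S="ball 0 (1 / real (Suc k))"])
    (auto intro: cutoff_eq_0_near)

lemma grad_cutoff_far: "norm x > 2 * real (Suc k) \<Longrightarrow> grad (cutoff k) x = 0"
  by (rule GDERIV_compact_support[OF GDERIV_cutoff cutoff_eq_0_far])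

section \<open>Products with the cutoff, continued by zero across the origin\<close>

lemma continuous_on_extend_by_0:
  fixes g :: "'a::real_normed_vector \<Rightarrow> 'b::real_normed_vector"
  assumes "continuous_on (- {0}) g" and "r > 0" and "\<And>x. norm x < r \<Longrightarrow> g x = 0"
  shows "continuous_on UNIV g"
proof -
  have "continuous_on (ball 0 r) g"
    by (rule continuous_on_eq[of _ "\<lambda>_. 0"]) (use assms in auto)
  then have "continuous_on (- {0} \<union> ball 0 r) g"
    using assms(1) by (intro continuous_on_open_Un) auto
  moreover have "- {0} \<union> ball 0 r = (UNIV :: 'a set)" using \<open>r > 0\<close> by auto
  ultimately show ?thesis by simp
qed

text \<open>The cutoff vanishes on a whole ball around the origin, so it removes any singularity of
  \<open>h\<close> there together with the value that \<open>h\<close> happens to take at the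
  origin.\<close>

lemma continuous_on_cutoff_scaleR:
  fixes h :: "real^'n \<Rightarrow> 'b::real_normed_vector"
  assumes "continuous_on (- {0}) h"
  shows "continuous_on UNIV (\<lambda>x. cutoff k x *\<^sub>R h x)"
  by (rule continuous_on_extend_by_0[of _ "1 / real (Suc k)"])
    (auto intro!: continuous_intros assms continuous_on_cutoff cutoff_eq_0_near)

lemma continuous_on_scaleR_grad_cutoff:
  fixes f :: "real^'n \<Rightarrow> real"
  assumes "continuous_on (- {0}) f"
  shows "continuous_on UNIV (\<lambda>x. f x *\<^sub>R grad (cutoff k) x)"
  by (rule continuous_on_extend_by_0[of _ "1 / real (Suc k)"])
    (auto intro!: continuous_intros assms continuous_on_subset[OF continuous_on_grad_cutoff]
      grad_cutoff_near)

text \<open>At the origin the value of \<open>Df\<close> is irrelevant, since there the cutoff vanishes.\<close>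

lemma GDERIV_cutoff_mult:
  assumes D: "\<And>x. x \<noteq> 0 \<Longrightarrow> GDERIV f x :> Df x"
  shows "GDERIV (\<lambda>x. cutoff k x * f x) x :> cutoff k x *\<^sub>R Df x + f x *\<^sub>R grad (cutoff k) x"
proof (cases "x = 0")
  case False
  show ?thesis by (rule GDERIV_mult[OF GDERIV_cutoff D[OF False]])
next
  case True
  have "GDERIV (\<lambda>x. cutoff k x * f x) x :> 0"
    unfolding gderiv_def
    by (rule has_derivative_transform_within_open[of "\<lambda>_. 0" _ _ _ "ball 0 (1 / real (Suc k))"])
      (use True in \<open>auto simp: cutoff_eq_0_near\<close>)
  then show ?thesis using True by (simp add: cutoff_eq_0_near grad_cutoff_near)
qed

lemma continuous_on_grad_cutoff_mult:
  assumes "\<And>x. x \<noteq> 0 \<Longrightarrow> GDERIV f x :> Df x" and "continuous_on (- {0}) Df"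
  shows "continuous_on UNIV (\<lambda>x. cutoff k x *\<^sub>R Df x + f x *\<^sub>R grad (cutoff k) x)"
  by (intro continuous_on_add continuous_on_cutoff_scaleR assms continuous_on_scaleR_grad_cutoff
      GDERIV_imp_continuous_on[of _ _ Df]) (use assms in auto)

subsection \<open>The energy identity\<close>

definition C2_off_origin :: "(real^'n \<Rightarrow> real) \<Rightarrow> bool" where
  "C2_off_origin u \<longleftrightarrow> continuous_on UNIV u \<and> Ck_on 2 (- {0}) u"

lemma C2_off_origin_GDERIV:
  assumes "C2_off_origin u"
  shows "x \<noteq> 0 \<Longrightarrow> GDERIV u x :> grad u x" and "continuous_on (- {0}) (grad u)"
    and "x \<noteq> 0 \<Longrightarrow> GDERIV (partial_deriv i u) x :> grad (partial_deriv i u) x"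
    and "continuous_on (- {0}) (grad (partial_deriv i u))"
proof -
  have 2: "Ck_on (Suc (Suc 0)) (- {0}) u" using assms by (simp add: C2_off_origin_def numeral_2_eq_2)
  have 1: "Ck_on (Suc 0) (- {0}) (partial_deriv i u)" for i
    using 2 by (simp add: Ck_on.simps(2))
  show "x \<noteq> 0 \<Longrightarrow> GDERIV u x :> grad u x" using Ck_on_SucD(1)[OF 2] by simp
  show "continuous_on (- {0}) (grad u)"
    by (rule continuous_on_vecI) (rule Ck_on_imp_continuous_on[OF Ck_on_SucD(2)[OF 2]])
  show "x \<noteq> 0 \<Longrightarrow> GDERIV (partial_deriv i u) x :> grad (partial_deriv i u) x"
    using Ck_on_SucD(1)[OF 1] by simp
  show "continuous_on (- {0}) (grad (partial_deriv i u))"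
    by (rule continuous_on_vecI) (rule Ck_on_imp_continuous_on[OF Ck_on_SucD(2)[OF 1]])
qed

lemma laplacian_eq: "laplacian u x = (\<Sum>i\<in>UNIV. grad (partial_deriv i u) x $ i)"
  by (simp add: laplacian_def grad_def)

lemma integrable_cutoff_mult:
  fixes h :: "real^'n \<Rightarrow> real"
  assumes "continuous_on (- {0}) h"
  shows "integrable lborel (\<lambda>x. cutoff k x * h x)"
  using integrable_compact_support[OF continuous_on_cutoff_scaleR[OF assms], of "2 * real (Suc k)" k]
  by (simp add: cutoff_eq_0_far)

lemma continuous_on_laplacian:
  assumes "C2_off_origin u"
  shows "continuous_on (- {0}) (laplacian u)"
  unfolding laplacian_eq[abs_def] using C2_off_origin_GDERIV(4)[OF assms]
  by (intro continuous_intros)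

text \<open>The vector field \<open>\<eta>\<^sup>2 f \<nabla>u\<close> is \<open>C\<^sup>1\<close> with compact support, so its divergence has integral zero.\<close>

lemma green_identity_cutoff:
  fixes f u :: "real^'n \<Rightarrow> real"
  assumes u: "C2_off_origin u"
    and Df: "\<And>x. x \<noteq> 0 \<Longrightarrow> GDERIV f x :> Df x" and cDf: "continuous_on (- {0}) Df"
  shows "(\<integral>x. (cutoff k x)\<^sup>2 * (Df x \<bullet> grad u x) \<partial>lborel)
      + (\<integral>x. 2 * cutoff k x * (f x * (grad (cutoff k) x \<bullet> grad u x)) \<partial>lborel)
      = (\<integral>x. (cutoff k x)\<^sup>2 * (f x * - laplacian u x) \<partial>lborel)"
proof -
  note D = C2_off_origin_GDERIV[OF u]
  let ?\<eta> = "cutoff k :: real^'n \<Rightarrow> real" and ?D\<eta> = "grad (cutoff k) :: real^'n \<Rightarrow> real^'n"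
  have cf: "continuous_on (- {0}) f" using Df by (intro GDERIV_imp_continuous_on) auto
  have c1: "continuous_on (- {0}) (\<lambda>x. grad u x $ i)" for i
    by (intro continuous_intros D(2))
  have c0: "continuous_on (- {0}) ?\<eta>" "continuous_on (- {0}) ?D\<eta>"
    using continuous_on_cutoff continuous_on_subset[OF continuous_on_grad_cutoff] by auto
  have "continuous_on (- {0}) (\<lambda>x. ?\<eta> x * (Df x \<bullet> grad u x))"
    by (intro continuous_intros c0 cDf D(2))
  from integrable_cutoff_mult[OF this, of k]
  have i1: "integrable lborel (\<lambda>x. (?\<eta> x)\<^sup>2 * (Df x \<bullet> grad u x))"
    by (simp add: power2_eq_square mult.assoc)
  have "continuous_on (- {0}) (\<lambda>x. 2 * (f x * (?D\<eta> x \<bullet> grad u x)))"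
    by (intro continuous_intros c0 cf D(2))
  from integrable_cutoff_mult[OF this, of k]
  have i2: "integrable lborel (\<lambda>x. 2 * ?\<eta> x * (f x * (?D\<eta> x \<bullet> grad u x)))"
    by (simp add: mult.left_commute mult.commute mult.assoc)
  have "continuous_on (- {0}) (\<lambda>x. ?\<eta> x * (f x * - laplacian u x))"
    by (intro continuous_intros c0 cf continuous_on_laplacian[OF u])
  from integrable_cutoff_mult[OF this, of k]
  have i3: "integrable lborel (\<lambda>x. (?\<eta> x)\<^sup>2 * (f x * - laplacian u x))"
    by (simp add: power2_eq_square mult.assoc)
  \<comment> \<open>The components of \<open>grad u\<close>; the i-th entries of their gradients add
    up to the Laplacian.\<close>
  define p where "p i = partial_deriv i u" for i
  have pg: "p i x = grad u x $ i" for i x by (simp add: p_def grad_def)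
  have cp: "continuous_on (- {0}) (p i)" for i using c1[of i] by (simp add: pg[symmetric])
  \<comment> \<open>\<open>g i\<close> and \<open>G i\<close> are the gradients of \<eta> f p_i and
    of \<eta>^2 f p_i. One factor \<eta> already makes the product C^1 on the whole space, so the
    ordinary product rule applies to the other.\<close>
  define g where "g i x = ?\<eta> x *\<^sub>R (f x *\<^sub>R grad (p i) x + p i x *\<^sub>R Df x) + (f x * p i x) *\<^sub>R ?D\<eta> x" for i x
  define G where "G i x = ?\<eta> x *\<^sub>R g i x + (?\<eta> x * (f x * p i x)) *\<^sub>R ?D\<eta> x" for i x
  have Dup: "GDERIV (\<lambda>x. f x * p i x) x :> f x *\<^sub>R grad (p i) x + p i x *\<^sub>R Df x" if "x \<noteq> 0" for i x
    unfolding p_def by (rule GDERIV_mult[OF Df[OF that] D(3)[OF that]])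
  have cup: "continuous_on (- {0}) (\<lambda>x. f x *\<^sub>R grad (p i) x + p i x *\<^sub>R Df x)" for i
    by (intro continuous_intros cf cp cDf) (simp add: p_def D(4))
  have Dg: "GDERIV (\<lambda>x. ?\<eta> x * (f x * p i x)) x :> g i x" for i x
    unfolding g_def by (rule GDERIV_cutoff_mult[OF Dup])
  have cg: "continuous_on UNIV (g i)" for i
    unfolding g_def by (rule continuous_on_grad_cutoff_mult[OF Dup cup])
  have DG: "GDERIV (\<lambda>x. ?\<eta> x * (?\<eta> x * (f x * p i x))) x :> G i x" for i x
    unfolding G_def by (rule GDERIV_mult[OF GDERIV_cutoff Dg])
  have cG: "continuous_on UNIV (G i)" for i
    unfolding G_def
    by (intro continuous_on_add continuous_on_scaleR cg continuous_on_cutoff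
        GDERIV_imp_continuous_on[OF Dg] continuous_on_grad_cutoff)
  \<comment> \<open>Only the i-th derivative of the i-th component enters the divergence.\<close>
  have z: "(\<integral>x. G i x $ i \<partial>lborel) = 0" for i
    using integral_grad_eq_0[OF DG cG, of "2 * real (Suc k)" i "axis i 1"]
    by (simp add: inner_axis' cutoff_eq_0_far)
  have iG: "integrable lborel (\<lambda>x. G i x $ i)" for i
  proof (rule integrable_compact_support[of _ "2 * real (Suc k) + 1"])
    show "continuous_on UNIV (\<lambda>x. G i x $ i)" by (intro continuous_intros cG)
    show "G i x $ i = 0" if "norm x \<ge> 2 * real (Suc k) + 1" for x
      using GDERIV_compact_support[OF DG[of i], of "2 * real (Suc k)" x] that by (simp add: cutoff_eq_0_far)
  qed
  have "(\<Sum>i\<in>UNIV. G i x $ i) = (?\<eta> x)\<^sup>2 * (Df x \<bullet> grad u x)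
      + 2 * ?\<eta> x * (f x * (?D\<eta> x \<bullet> grad u x)) - (?\<eta> x)\<^sup>2 * (f x * - laplacian u x)" for x
  proof -
    have "(\<Sum>i\<in>UNIV. G i x $ i) = (\<Sum>i\<in>UNIV. (?\<eta> x)\<^sup>2 * (Df x $ i * grad u x $ i)
      + 2 * ?\<eta> x * (f x * (?D\<eta> x $ i * grad u x $ i)) + (?\<eta> x)\<^sup>2 * (f x * grad (p i) x $ i))"
      by (intro sum.cong) (auto simp: G_def g_def pg power2_eq_square algebra_simps)
    also have "\<dots> = (?\<eta> x)\<^sup>2 * (Df x \<bullet> grad u x)
      + 2 * ?\<eta> x * (f x * (?D\<eta> x \<bullet> grad u x)) + (?\<eta> x)\<^sup>2 * (f x * laplacian u x)"
      by (simp add: sum.distrib sum_distrib_left[symmetric] inner_vec_def laplacian_eq p_def)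
    finally show ?thesis by simp
  qed
  then have "(\<integral>x. (?\<eta> x)\<^sup>2 * (Df x \<bullet> grad u x) + 2 * ?\<eta> x * (f x * (?D\<eta> x \<bullet> grad u x))
      - (?\<eta> x)\<^sup>2 * (f x * - laplacian u x) \<partial>lborel) = (\<integral>x. (\<Sum>i\<in>UNIV. G i x $ i) \<partial>lborel)"
    by simp
  also have "\<dots> = 0"
    using iG z by simp
  finally show ?thesis
    using i1 i2 i3 by simp
qed

subsection \<open>Decay of the cutoff error\<close>

text \<open>\<open>C\<close> may blow up as \<open>\<epsilon>\<close> shrinks, since it is fixed
  before \<open>j\<close> tends to infinity. This turns Young-type estimates with a free parameter
  into limits.\<close>

lemma tendsto_0_by_two_scales:
  fixes a T :: "nat \<Rightarrow> real"
  assumes "\<And>\<epsilon>. \<epsilon> > 0 \<Longrightarrow> \<exists>C. \<forall>j. \<bar>a j\<bar> \<le> \<epsilon> + C * T j" and T: "T \<longlonglongrightarrow> 0"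
  shows "a \<longlonglongrightarrow> 0"
proof (rule LIMSEQ_I)
  fix r :: real assume "r > 0"
  then obtain C where C: "\<And>j. \<bar>a j\<bar> \<le> r / 2 + C * T j"
    using assms(1)[of "r / 2"] by auto
  have "(\<lambda>j. C * T j) \<longlonglongrightarrow> C * 0" by (intro tendsto_intros T)
  then have "\<forall>\<^sub>F j in sequentially. C * T j < r / 2"
    using \<open>r > 0\<close> by (intro order_tendstoD(2)[of _ 0]) auto
  then obtain N where N: "\<And>j. j \<ge> N \<Longrightarrow> C * T j < r / 2"
    unfolding eventually_sequentially by blast
  have "norm (a j - 0) < r" if "j \<ge> N" for j
    using C[of j] N[OF that] by simp
  then show "\<exists>N. \<forall>j\<ge>N. norm (a j - 0) < r" by blast
qed

text \<open>Young's inequality for the product of \<sigma> a^2 and 1 / (\<sigma> r^2), with the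
  conjugate exponents n / (n - 2) and n / 2. The former produces the power 2n / (n - 2) of |a|, the
  latter r^(-n), and \<sigma> trades one term against the other.\<close>

lemma scaled_Young:
  fixes n :: nat and a r \<sigma> :: real
  assumes "n \<ge> 3" "\<sigma> > 0" "r > 0"
  shows "a\<^sup>2 / r\<^sup>2 \<le> \<sigma> powr (n / (n - 2)) * \<bar>a\<bar> powr (2 * n / (n - 2)) + \<sigma> powr (- (n / 2)) / r ^ n"
proof -
  define P where "P = real n / (real n - 2)"
  define Q where "Q = real n / 2"
  have PQ: "P > 1" "Q > 1" "1 / P + 1 / Q = 1"
    using assms(1) by (auto simp: P_def Q_def field_simps)
  have "(\<sigma> * a\<^sup>2) * (1 / (\<sigma> * r\<^sup>2)) \<le> (\<sigma> * a\<^sup>2) powr P / P + (1 / (\<sigma> * r\<^sup>2)) powr Q / Q"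
    using assms by (intro Youngs_inequality PQ) auto
  also have "\<dots> \<le> (\<sigma> * a\<^sup>2) powr P + (1 / (\<sigma> * r\<^sup>2)) powr Q"
    using PQ by (intro add_mono) (auto simp: divide_le_eq mult_left_le mult_le_cancel_left1)
  also have "(\<sigma> * a\<^sup>2) powr P = \<sigma> powr P * \<bar>a\<bar> powr (2 * P)"
  proof -
    have "a\<^sup>2 = \<bar>a\<bar> powr 2" by (cases "a = 0") (auto simp: powr_numeral)
    then have "(a\<^sup>2) powr P = \<bar>a\<bar> powr (2 * P)" by (simp only: powr_powr)
    then show ?thesis using assms by (simp add: powr_mult)
  qed
  also have "(1 / (\<sigma> * r\<^sup>2)) powr Q = \<sigma> powr (- Q) / r ^ n"
  proof -
    have "r\<^sup>2 = r powr 2" using assms by (simp add: powr_numeral)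
    then have "(r\<^sup>2) powr Q = r powr (2 * Q)" by (simp only: powr_powr)
    then have "(\<sigma> * r\<^sup>2) powr Q = \<sigma> powr Q * r powr n"
      using assms by (simp add: powr_mult Q_def)
    then show ?thesis
      using assms by (simp add: powr_divide powr_minus powr_realpow field_simps)
  qed
  finally show ?thesis
    using assms by (simp add: P_def Q_def of_nat_diff)
qed

lemma measure_ball_eq:
  "r \<ge> 0 \<Longrightarrow> measure lborel (ball (0::real^'n) r) = unit_ball_vol (real CARD('n)) * r ^ CARD('n)"
  using content_ball[of r "0::real^'n"] by simp

lemma integrable_indicator_bounded:
  fixes A :: "'a::euclidean_space set"
  assumes "A \<in> sets borel" "bounded A"
  shows "integrable lborel (\<lambda>x. indicator A x :: real)"
  using assms emeasure_bounded_finite[OF assms(2)] by (intro integrable_real_indicator) auto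

text \<open>For a fixed Young parameter \<sigma> the error is at most a constant times
  \<sigma>^(n/(n-2)) \<open>T k\<close> + \<sigma>^(-n/2), the second term coming from volumes that
  the scaling keeps bounded. A large \<sigma> makes this term small; with \<sigma> fixed, the mass
  \<open>T k\<close> of |u|^p on the supporting regions tends to zero.\<close>

lemma cutoff_error_tendsto_0:
  fixes u :: "real^'n \<Rightarrow> real"
  assumes n: "CARD('n) \<ge> 3" and cu: "continuous_on UNIV u"
    and iu: "integrable lborel (\<lambda>x. \<bar>u x\<bar> powr (2 * real CARD('n) / (real CARD('n) - 2)))"
  shows "(\<lambda>k. \<integral>x. (u x)\<^sup>2 * (norm (grad (cutoff k) x))\<^sup>2 \<partial>lborel) \<longlonglongrightarrow> 0"
proof -
  let ?n = "CARD('n)"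
  define w where "w x = \<bar>u x\<bar> powr (2 * real ?n / (real ?n - 2))" for x
  define A where "A k = ball (0::real^'n) (2 / real (Suc k))" for k
  define B where "B k = ball (0::real^'n) (2 * real (Suc k)) - ball 0 (real (Suc k))" for k
  have [measurable]: "A k \<in> sets borel" "B k \<in> sets borel" for k by (auto simp: A_def B_def)
  have bdd: "bounded (A k)" "bounded (B k)" for k by (auto simp: A_def B_def bounded_diff)
  have [measurable]: "u \<in> borel_measurable borel" by (rule borel_measurable_continuous_onI[OF cu])
  have iw: "integrable lborel w" using iu by (simp add: w_def[abs_def])
  have iwi: "integrable lborel (\<lambda>x. indicator S x * w x)" if "S \<in> sets borel" for S
    using integrable_mult_indicator[OF _ iw, of S] that by simp
  define T where "T k = (\<integral>x. (indicator (A k) x + indicator (B k) x) * w x \<partial>lborel)" for k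
  obtain M where M: "M > 0" "\<And>k x::real^'n. norm (grad (cutoff k) x)
      \<le> M * (real (Suc k) * indicator (A k) x + inverse (real (Suc k)) * indicator (B k) x)"
    unfolding A_def B_def by (rule cutoff_C1) blast
  \<comment> \<open>The rescaled volume of \<open>A k\<close>, and a bound for that of
    \<open>B k\<close> when the hole of the shell is filled.\<close>
  define V where "V = unit_ball_vol (real ?n) * 2 ^ ?n"
  have V: "V > 0" unfolding V_def using unit_ball_vol_pos by simp
  have volA: "real (Suc k) ^ ?n * measure lborel (A k) = V" for k
    unfolding A_def by (subst measure_ball_eq) (auto simp: V_def power_divide)
  have volB: "inverse (real (Suc k)) ^ ?n * measure lborel (B k) \<le> V" for k
  proof -
    have "measure lborel (B k) \<le> measure lborel (ball (0::real^'n) (2 * real (Suc k)))"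
      using emeasure_bounded_finite[OF bounded_ball]
      by (intro measure_mono_fmeasurable) (auto simp: B_def fmeasurable_def)
    also have "\<dots> = V * real (Suc k) ^ ?n"
      by (subst measure_ball_eq) (auto simp: V_def power_mult_distrib simp del: of_nat_Suc)
    finally have "inverse (real (Suc k)) ^ ?n * measure lborel (B k) \<le> inverse (real (Suc k)) ^ ?n * (V * real (Suc k) ^ ?n)"
      by (intro mult_left_mono) auto
    also have "\<dots> = V" by (simp add: power_inverse del: of_nat_Suc)
    finally show ?thesis .
  qed
  have bound: "(\<integral>x. (u x)\<^sup>2 * (norm (grad (cutoff k) x))\<^sup>2 \<partial>lborel)
      \<le> 2 * M\<^sup>2 * (\<sigma> powr (?n / (?n - 2)) * T k + \<sigma> powr (- (?n / 2)) * (2 * V))" if s: "\<sigma> > 0" for \<sigma> k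
  proof -
    define c where "c = real (Suc k)"
    have c: "c > 0" by (simp add: c_def)
    let ?s = "\<sigma> powr (?n / (?n - 2))" and ?q = "\<sigma> powr (- (?n / 2))"
    let ?F = "\<lambda>x. 2 * M\<^sup>2 * (?s * ((indicator (A k) x + indicator (B k) x) * w x)
      + ?q * (c ^ ?n * indicator (A k) x + inverse c ^ ?n * indicator (B k) x))"
    have iF: "integrable lborel (\<lambda>x. (indicator (A k) x + indicator (B k) x) * w x)"
      unfolding distrib_right by (intro Bochner_Integration.integrable_add iwi) auto
    have iG: "integrable lborel (\<lambda>x. c ^ ?n * indicator (A k) x + inverse c ^ ?n * indicator (B k) x)"
      by (intro Bochner_Integration.integrable_add integrable_mult_right integrable_indicator_bounded bdd) auto
    have pt: "(u x)\<^sup>2 * (norm (grad (cutoff k) x))\<^sup>2 \<le> ?F x" for x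
    proof -
      \<comment> \<open>Young's inequality at the two scales: \<open>r = inverse c\<close> near the
        origin and \<open>r = c\<close> far out.\<close>
      have 1: "(u x)\<^sup>2 * c\<^sup>2 \<le> ?s * w x + ?q * c ^ ?n"
        using scaled_Young[OF n s, of "inverse c" "u x"] c n
        by (simp add: w_def of_nat_diff field_simps power_inverse)
      have 2: "(u x)\<^sup>2 * (inverse c)\<^sup>2 \<le> ?s * w x + ?q * inverse c ^ ?n"
        using scaled_Young[OF n s, of "c" "u x"] c n
        by (simp add: w_def of_nat_diff field_simps power_inverse)
      have "(norm (grad (cutoff k) x))\<^sup>2 \<le> (M * (c * indicator (A k) x + inverse c * indicator (B k) x))\<^sup>2"
        using M(2)[of k x] by (intro power_mono) (auto simp: c_def)
      \<comment> \<open>For \<open>k = 0\<close> the ball and the shell overlap, so the square of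
        the sum is bounded by twice the sum of the squares.\<close>
      also have "\<dots> \<le> 2 * M\<^sup>2 * (c\<^sup>2 * indicator (A k) x + (inverse c)\<^sup>2 * indicator (B k) x)"
      proof -
        have "(c * indicator (A k) x + inverse c * indicator (B k) x)\<^sup>2
            \<le> 2 * ((c * indicator (A k) x)\<^sup>2 + (inverse c * indicator (B k) x)\<^sup>2)"
          using sum_squares_bound[of "c * indicator (A k) x" "inverse c * indicator (B k) x"]
          by (simp add: power2_sum)
        also have "\<dots> = 2 * (c\<^sup>2 * indicator (A k) x + (inverse c)\<^sup>2 * indicator (B k) x)"
          by (auto simp: indicator_def)
        finally have "M\<^sup>2 * (c * indicator (A k) x + inverse c * indicator (B k) x)\<^sup>2
            \<le> M\<^sup>2 * (2 * (c\<^sup>2 * indicator (A k) x + (inverse c)\<^sup>2 * indicator (B k) x))"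
          by (rule mult_left_mono) simp
        then show ?thesis by (simp only: power_mult_distrib[of M] mult.assoc mult.left_commute[of "M\<^sup>2"])
      qed
      finally have "(u x)\<^sup>2 * (norm (grad (cutoff k) x))\<^sup>2
          \<le> (u x)\<^sup>2 * (2 * M\<^sup>2 * (c\<^sup>2 * indicator (A k) x + (inverse c)\<^sup>2 * indicator (B k) x))"
        by (intro mult_left_mono) auto
      also have "\<dots> = 2 * M\<^sup>2 * ((u x)\<^sup>2 * c\<^sup>2 * indicator (A k) x + (u x)\<^sup>2 * (inverse c)\<^sup>2 * indicator (B k) x)"
        by (simp add: algebra_simps)
      also have "\<dots> \<le> 2 * M\<^sup>2 * ((?s * w x + ?q * c ^ ?n) * indicator (A k) x
          + (?s * w x + ?q * inverse c ^ ?n) * indicator (B k) x)"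
        by (intro mult_left_mono add_mono mult_right_mono 1 2) auto
      also have "\<dots> = ?F x" by (simp add: algebra_simps)
      finally show ?thesis .
    qed
    have "(\<integral>x. (u x)\<^sup>2 * (norm (grad (cutoff k) x))\<^sup>2 \<partial>lborel) \<le> (\<integral>x. ?F x \<partial>lborel)"
    proof (rule integral_mono)
      show "integrable lborel (\<lambda>x. (u x)\<^sup>2 * (norm (grad (cutoff k) x))\<^sup>2)"
        by (rule integrable_compact_support[of _ "2 * real (Suc k) + 1"])
          (auto intro!: continuous_intros cu continuous_on_grad_cutoff grad_cutoff_far)
      show "integrable lborel ?F"
        using iF by (intro integrable_mult_right Bochner_Integration.integrable_add
            integrable_indicator_bounded bdd) auto
    qed (rule pt)
    also have "\<dots> = 2 * M\<^sup>2 * (?s * T k + ?q * (c ^ ?n * measure lborel (A k) + inverse c ^ ?n * measure lborel (B k)))"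
    proof -
      have "(\<integral>x. c ^ ?n * indicator (A k) x + inverse c ^ ?n * indicator (B k) x \<partial>lborel)
          = c ^ ?n * measure lborel (A k) + inverse c ^ ?n * measure lborel (B k)"
        by (subst Bochner_Integration.integral_add)
          (auto intro!: integrable_mult_right integrable_indicator_bounded bdd)
      then show ?thesis using iF iG by (simp add: T_def)
    qed
    also have "\<dots> \<le> 2 * M\<^sup>2 * (?s * T k + ?q * (2 * V))"
      using volA[of k] volB[of k] by (intro mult_left_mono add_left_mono) (auto simp: c_def)
    finally show ?thesis .
  qed
  have T: "T \<longlonglongrightarrow> 0"
  proof -
    have "(\<lambda>k. \<integral>x. (indicator (A k) x + indicator (B k) x) * w x \<partial>lborel) \<longlonglongrightarrow> (\<integral>x. 0 \<partial>(lborel :: (real^'n) measure))"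
    proof (rule integral_dominated_convergence)
      show "integrable lborel (\<lambda>x. 2 * w x)" using iw by simp
      show "(\<lambda>x. (indicator (A k) x + indicator (B k) x) * w x) \<in> borel_measurable lborel" for k
        unfolding w_def by measurable
      show "AE x in lborel. norm ((indicator (A k) x + indicator (B k) x) * w x) \<le> 2 * w x" for k
        by (auto simp: w_def indicator_def)
      \<comment> \<open>Every point other than the origin eventually leaves both the shrinking ball
        and the receding shell.\<close>
      have "(\<lambda>k. (indicator (A k) x + indicator (B k) x) * w x) \<longlonglongrightarrow> 0" if "x \<noteq> 0" for x
      proof -
        obtain N where N: "real N > max (norm x) (2 / norm x)" using reals_Archimedean2 by blast
        have "(indicator (A k) x + indicator (B k) x) * w x = 0" if "k \<ge> N" for k
        proof -
          have "real (Suc k) > norm x" "real (Suc k) > 2 / norm x" using N that by auto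
          then have "norm x < real (Suc k)" "2 / real (Suc k) < norm x"
            using \<open>x \<noteq> 0\<close> by (auto simp: field_simps)
          then show ?thesis by (simp add: A_def B_def del: of_nat_Suc)
        qed
        then show ?thesis by (intro tendsto_eventually) (auto simp: eventually_sequentially)
      qed
      then have "\<And>x. x \<notin> {0} \<Longrightarrow> (\<lambda>k. (indicator (A k) x + indicator (B k) x) * w x) \<longlonglongrightarrow> 0" by simp
      then show "AE x in lborel. (\<lambda>k. (indicator (A k) x + indicator (B k) x) * w x) \<longlonglongrightarrow> 0"
        using AE_lborel_singleton[of "0::real^'n"] by (auto elim!: eventually_mono)
    qed simp
    then show ?thesis by (simp add: T_def[abs_def])
  qed
  show ?thesis
  proof (rule tendsto_0_by_two_scales[OF _ T])
    fix \<epsilon> :: real assume "\<epsilon> > 0"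
    \<comment> \<open>\<sigma> is chosen before \<open>k\<close>, to bring the volume term below
      \<open>\<epsilon>\<close> for all \<open>k\<close> at once.\<close>
    have "((\<lambda>\<sigma>. 4 * M\<^sup>2 * V * \<sigma> powr (- (?n / 2))) \<longlongrightarrow> 4 * M\<^sup>2 * V * 0) at_top"
      using n by (intro tendsto_mult tendsto_const tendsto_neg_powr filterlim_ident) auto
    then have "\<forall>\<^sub>F \<sigma> in at_top. 4 * M\<^sup>2 * V * \<sigma> powr (- (?n / 2)) < \<epsilon>"
      using \<open>\<epsilon> > 0\<close> by (intro order_tendstoD(2)[of _ 0]) auto
    moreover have "\<forall>\<^sub>F \<sigma>::real in at_top. \<sigma> > 0" by (rule eventually_gt_at_top)
    ultimately have "\<forall>\<^sub>F \<sigma>::real in at_top. \<sigma> > 0 \<and> 4 * M\<^sup>2 * V * \<sigma> powr (- (?n / 2)) < \<epsilon>"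
      by eventually_elim simp
    then obtain \<sigma> where s: "\<sigma> > 0" "4 * M\<^sup>2 * V * \<sigma> powr (- (?n / 2)) < \<epsilon>"
      unfolding eventually_at_top_linorder by blast
    have "\<bar>\<integral>x. (u x)\<^sup>2 * (norm (grad (cutoff k) x))\<^sup>2 \<partial>lborel\<bar>
        \<le> \<epsilon> + 2 * M\<^sup>2 * \<sigma> powr (?n / (?n - 2)) * T k" for k
    proof -
      have "\<bar>\<integral>x. (u x)\<^sup>2 * (norm (grad (cutoff k) x))\<^sup>2 \<partial>lborel\<bar> = (\<integral>x. (u x)\<^sup>2 * (norm (grad (cutoff k) x))\<^sup>2 \<partial>lborel)"
        by (intro abs_of_nonneg Bochner_Integration.integral_nonneg) auto
      also have "\<dots> \<le> 2 * M\<^sup>2 * (\<sigma> powr (?n / (?n - 2)) * T k + \<sigma> powr (- (?n / 2)) * (2 * V))"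
        by (rule bound[OF s(1)])
      also have "\<dots> = 4 * M\<^sup>2 * V * \<sigma> powr (- (?n / 2)) + 2 * M\<^sup>2 * \<sigma> powr (?n / (?n - 2)) * T k"
        by (simp add: algebra_simps)
      finally show ?thesis using s(2) by linarith
    qed
    then show "\<exists>C. \<forall>k. \<bar>\<integral>x. (u x)\<^sup>2 * (norm (grad (cutoff k) x))\<^sup>2 \<partial>lborel\<bar> \<le> \<epsilon> + C * T k"
      by blast
  qed
qed

subsection \<open>Passage to the limit in the energy identity\<close>

lemma integrable_cutoff_sq_mult:
  fixes h :: "real^'n \<Rightarrow> real"
  assumes "continuous_on (- {0}) h"
  shows "integrable lborel (\<lambda>x. (cutoff k x)\<^sup>2 * h x)"
  using integrable_cutoff_mult[of "\<lambda>x. cutoff k x * h x" k]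
    continuous_on_mult[OF continuous_on_cutoff assms, of k]
  by (simp add: power2_eq_square mult.assoc)

text \<open>The integrals are squeezed between \<eta>^2 \<le> 1 from above and Fatou's lemma from
  below, which also covers an infinite limit.\<close>

lemma nn_integral_cutoff_tendsto:
  fixes f :: "real^'n \<Rightarrow> real"
  assumes [measurable]: "f \<in> borel_measurable borel" and nn: "\<And>x. x \<noteq> 0 \<Longrightarrow> f x \<ge> 0"
  shows "(\<lambda>k. \<integral>\<^sup>+x. ennreal ((cutoff k x)\<^sup>2 * f x) \<partial>lborel) \<longlonglongrightarrow> (\<integral>\<^sup>+x. ennreal (f x) \<partial>lborel)"
proof (rule order_tendstoI)
  have [measurable]: "cutoff k \<in> borel_measurable borel" for k :: nat
    by (rule borel_measurable_continuous_onI[OF continuous_on_cutoff])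
  have AE0: "AE x in lborel. x \<noteq> (0::real^'n)" by (rule AE_lborel_singleton)
  have le: "(\<integral>\<^sup>+x. ennreal ((cutoff k x)\<^sup>2 * f x) \<partial>lborel) \<le> (\<integral>\<^sup>+x. ennreal (f x) \<partial>lborel)" for k
    using AE0
    by (intro nn_integral_mono_AE)
      (auto elim!: eventually_mono intro!: ennreal_leI mult_left_le_one_le nn power_le_one cutoff_range)
  show "\<forall>\<^sub>F k in sequentially. (\<integral>\<^sup>+x. ennreal ((cutoff k x)\<^sup>2 * f x) \<partial>lborel) < a"
    if "(\<integral>\<^sup>+x. ennreal (f x) \<partial>lborel) < a" for a
    using le_less_trans[OF le that] by simp
  have lim: "liminf (\<lambda>k. ennreal ((cutoff k x)\<^sup>2 * f x)) = ennreal (f x)" if "x \<noteq> 0" for x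
  proof (rule lim_imp_Liminf)
    have "(\<lambda>k. (cutoff k x)\<^sup>2 * f x) \<longlonglongrightarrow> 1\<^sup>2 * f x"
      by (intro tendsto_intros cutoff_tendsto_1 that)
    then show "(\<lambda>k. ennreal ((cutoff k x)\<^sup>2 * f x)) \<longlonglongrightarrow> ennreal (f x)"
      by (intro tendsto_ennrealI) simp
  qed simp
  have "(\<integral>\<^sup>+x. ennreal (f x) \<partial>lborel) = (\<integral>\<^sup>+x. liminf (\<lambda>k. ennreal ((cutoff k x)\<^sup>2 * f x)) \<partial>lborel)"
    using AE0 by (intro nn_integral_cong_AE) (auto elim!: eventually_mono simp: lim)
  also have "\<dots> \<le> liminf (\<lambda>k. \<integral>\<^sup>+x. ennreal ((cutoff k x)\<^sup>2 * f x) \<partial>lborel)"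
    by (rule nn_integral_liminf) measurable
  finally show "\<forall>\<^sub>F k in sequentially. a < (\<integral>\<^sup>+x. ennreal ((cutoff k x)\<^sup>2 * f x) \<partial>lborel)"
    if "a < (\<integral>\<^sup>+x. ennreal (f x) \<partial>lborel)" for a
    using less_LiminfD less_le_trans[OF that] by blast
qed

lemma borel_measurable_off_origin:
  fixes f :: "real^'n \<Rightarrow> 'b::topological_space"
  assumes "continuous_on (- {0}) f"
  shows "f \<in> borel_measurable borel"
  using assms by (intro borel_measurable_continuous_countable_exceptions[of "{0}"]) auto

text \<open>The absorption argument in abstract form, with \<open>G\<close> the gradient energy,
  \<open>F\<close> the weighted energy and \<open>E\<close> the cutoff error. For
  \<open>s = 1/2\<close> the term \<open>G k / 2\<close> can be absorbed, so a bound on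
  \<open>F\<close> yields one on \<open>G\<close>; once \<open>G\<close> is bounded, a small
  \<open>s\<close> makes the difference vanish in the limit.\<close>

lemma perturbed_limit:
  fixes F G E :: "nat \<Rightarrow> real"
  assumes nn: "\<And>k. F k \<ge> 0" "\<And>k. G k \<ge> 0" and E: "E \<longlonglongrightarrow> 0"
    and le: "\<And>k s. s > 0 \<Longrightarrow> \<bar>F k - G k\<bar> \<le> s * G k + E k / s"
    and bdd: "(\<exists>M. \<forall>k. G k \<le> M) \<or> (\<exists>M. \<forall>k. F k \<le> M)"
  obtains M where "\<And>k. G k \<le> M" "(\<lambda>k. F k - G k) \<longlonglongrightarrow> 0"
proof -
  obtain C where C: "\<And>k. \<bar>E k\<bar> \<le> C"
    using convergent_imp_Bseq[of E] E unfolding Bseq_def convergent_def by auto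
  have half: "\<bar>F k - G k\<bar> \<le> G k / 2 + 2 * E k" for k
    using le[of "1/2" k] by simp
  obtain M where M: "\<And>k. G k \<le> M"
  proof (cases "\<exists>M. \<forall>k. G k \<le> M")
    case False
    then obtain M where M: "\<And>k. F k \<le> M" using bdd by blast
    have "G k \<le> 2 * M + 4 * C" for k
      using half[of k] M[of k] C[of k] by linarith
    then show ?thesis using that by blast
  qed blast
  have "(\<lambda>k. F k - G k) \<longlonglongrightarrow> 0"
  proof (rule tendsto_0_by_two_scales[OF _ E])
    fix \<epsilon> :: real assume "\<epsilon> > 0"
    \<comment> \<open>\<open>\<bar>M\<bar> + 1\<close> dominates every \<open>G k\<close> and is
      positive whatever the sign of \<open>M\<close>.\<close>
    define s where "s = \<epsilon> / (\<bar>M\<bar> + 1)"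
    have "s > 0" using \<open>\<epsilon> > 0\<close> by (simp add: s_def)
    have "s * G k \<le> s * (\<bar>M\<bar> + 1)" for k
      using M[of k] \<open>s > 0\<close> by (intro mult_left_mono) auto
    then have "s * G k \<le> \<epsilon>" for k by (simp add: s_def)
    then have "\<bar>F k - G k\<bar> \<le> \<epsilon> + (1 / s) * E k" for k
      using order_trans[OF le[OF \<open>s > 0\<close>, of k] add_right_mono] by simp
    then show "\<exists>C. \<forall>k. \<bar>F k - G k\<bar> \<le> \<epsilon> + C * E k" by blast
  qed
  then show ?thesis using that M by blast
qed

text \<open>By Green's identity with \<open>f = u\<close> the difference of the two energies is the
  cross term, which 2ab \<le> s a^2 + b^2 / s splits into a multiple of the gradient energy and the
  cutoff error.\<close>

lemma energy_error_bound:
  fixes u :: "real^'n \<Rightarrow> real"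
  assumes u: "C2_off_origin u" and "s > 0"
  shows "\<bar>(\<integral>x. (cutoff k x)\<^sup>2 * (u x * - laplacian u x) \<partial>lborel)
      - (\<integral>x. (cutoff k x)\<^sup>2 * (norm (grad u x))\<^sup>2 \<partial>lborel)\<bar>
    \<le> s * (\<integral>x. (cutoff k x)\<^sup>2 * (norm (grad u x))\<^sup>2 \<partial>lborel)
      + (\<integral>x. (u x)\<^sup>2 * (norm (grad (cutoff k) x))\<^sup>2 \<partial>lborel) / s"
proof -
  note D = C2_off_origin_GDERIV[OF u]
  let ?X = "\<lambda>x. 2 * cutoff k x * (u x * (grad (cutoff k) x \<bullet> grad u x))"
  have cu: "continuous_on UNIV u" using u by (simp add: C2_off_origin_def)
  have iG: "integrable lborel (\<lambda>x. (cutoff k x)\<^sup>2 * (norm (grad u x))\<^sup>2)"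
    by (intro integrable_cutoff_sq_mult continuous_intros D(2))
  have iE: "integrable lborel (\<lambda>x. (u x)\<^sup>2 * (norm (grad (cutoff k) x))\<^sup>2)"
    by (rule integrable_compact_support[of _ "2 * real (Suc k) + 1"])
      (auto intro!: continuous_intros cu continuous_on_grad_cutoff grad_cutoff_far)
  have eq: "(\<integral>x. (cutoff k x)\<^sup>2 * (u x * - laplacian u x) \<partial>lborel)
      - (\<integral>x. (cutoff k x)\<^sup>2 * (norm (grad u x))\<^sup>2 \<partial>lborel) = (\<integral>x. ?X x \<partial>lborel)"
    using green_identity_cutoff[OF u D(1) D(2), of k] by (simp add: power2_norm_eq_inner)
  have pt: "\<bar>?X x\<bar> \<le> s * ((cutoff k x)\<^sup>2 * (norm (grad u x))\<^sup>2) + (u x)\<^sup>2 * (norm (grad (cutoff k) x))\<^sup>2 / s" for x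
  proof -
    define a where "a = cutoff k x * norm (grad u x)"
    define b where "b = \<bar>u x\<bar> * norm (grad (cutoff k) x)"
    have "\<bar>?X x\<bar> = 2 * (cutoff k x * \<bar>u x\<bar>) * \<bar>grad (cutoff k) x \<bullet> grad u x\<bar>"
      using cutoff_range(1)[of k x] by (simp add: abs_mult)
    also have "\<dots> \<le> 2 * (cutoff k x * \<bar>u x\<bar>) * (norm (grad (cutoff k) x) * norm (grad u x))"
      using cutoff_range(1)[of k x] by (intro mult_left_mono Cauchy_Schwarz_ineq2) auto
    also have "\<dots> = 2 * a * b" by (simp add: a_def b_def)
    also have "\<dots> \<le> s * a\<^sup>2 + b\<^sup>2 / s"
    proof -
      have "0 \<le> (s * a - b)\<^sup>2 / s" using \<open>s > 0\<close> by simp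
      also have "\<dots> = s * a\<^sup>2 + b\<^sup>2 / s - 2 * a * b"
        using \<open>s > 0\<close> by (simp add: field_simps power2_eq_square)
      finally show ?thesis by simp
    qed
    finally show ?thesis by (simp add: a_def b_def power_mult_distrib)
  qed
  have "\<bar>\<integral>x. ?X x \<partial>lborel\<bar> \<le> (\<integral>x. s * ((cutoff k x)\<^sup>2 * (norm (grad u x))\<^sup>2)
      + (u x)\<^sup>2 * (norm (grad (cutoff k) x))\<^sup>2 / s \<partial>lborel)"
  proof (cases "integrable lborel ?X")
    case True
    have "\<bar>\<integral>x. ?X x \<partial>lborel\<bar> \<le> (\<integral>x. \<bar>?X x\<bar> \<partial>lborel)" by (rule integral_abs_bound)
    also have "\<dots> \<le> (\<integral>x. s * ((cutoff k x)\<^sup>2 * (norm (grad u x))\<^sup>2)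
      + (u x)\<^sup>2 * (norm (grad (cutoff k) x))\<^sup>2 / s \<partial>lborel)"
      using True iG iE by (intro integral_mono pt) auto
    finally show ?thesis .
  next
    \<comment> \<open>The Bochner integral of a non-integrable function is zero, so this case
      reduces to the nonnegativity of the right-hand side.\<close>
    case False
    have "0 \<le> (\<integral>x. s * ((cutoff k x)\<^sup>2 * (norm (grad u x))\<^sup>2)
      + (u x)\<^sup>2 * (norm (grad (cutoff k) x))\<^sup>2 / s \<partial>lborel)"
      using \<open>s > 0\<close> by (intro Bochner_Integration.integral_nonneg) auto
    then show ?thesis using not_integrable_integral_eq[OF False] by linarith
  qed
  then show ?thesis unfolding eq using iG iE by simp
qed

text \<open>The disjunction \<open>bdd\<close> serves both parts of the theorem: membership in
  \<open>D12\<close> bounds the gradient energy, an integrable weight bounds the other one. Either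
  way both cutoff energies tend to the same finite number, and exhaustion identifies their limits
  with the full integrals.\<close>

lemma energy_equality:
  fixes u :: "real^'n \<Rightarrow> real"
  assumes n: "CARD('n) \<ge> 3" and u: "C2_off_origin u"
    and iu: "integrable lborel (\<lambda>x. \<bar>u x\<bar> powr (2 * real CARD('n) / (real CARD('n) - 2)))"
    and nn: "\<And>x. x \<noteq> 0 \<Longrightarrow> u x * - laplacian u x \<ge> 0"
    and bdd: "(\<exists>M. \<forall>k. (\<integral>x. (cutoff k x)\<^sup>2 * (norm (grad u x))\<^sup>2 \<partial>lborel) \<le> M)
      \<or> (\<exists>M. \<forall>k. (\<integral>x. (cutoff k x)\<^sup>2 * (u x * - laplacian u x) \<partial>lborel) \<le> M)"
  shows "(\<integral>\<^sup>+x. ennreal ((norm (grad u x))\<^sup>2) \<partial>lborel) = (\<integral>\<^sup>+x. ennreal (u x * - laplacian u x) \<partial>lborel)"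
    and "(\<integral>\<^sup>+x. ennreal ((norm (grad u x))\<^sup>2) \<partial>lborel) < \<infinity>"
proof -
  note D = C2_off_origin_GDERIV[OF u]
  have cu: "continuous_on UNIV u" using u by (simp add: C2_off_origin_def)
  have cw: "continuous_on (- {0}) (\<lambda>x. u x * - laplacian u x)"
    by (intro continuous_intros continuous_on_laplacian[OF u] continuous_on_subset[OF cu]) auto
  have cg: "continuous_on (- {0}) (\<lambda>x. (norm (grad u x))\<^sup>2)"
    by (intro continuous_intros D(2))
  define F where "F k = (\<integral>x. (cutoff k x)\<^sup>2 * (u x * - laplacian u x) \<partial>lborel)" for k
  define G where "G k = (\<integral>x. (cutoff k x)\<^sup>2 * (norm (grad u x))\<^sup>2 \<partial>lborel)" for k
  have AE0: "AE x in lborel. x \<noteq> (0::real^'n)" by (rule AE_lborel_singleton)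
  have AEF: "AE x in lborel. 0 \<le> (cutoff k x)\<^sup>2 * (u x * - laplacian u x)" for k
    using AE0 by eventually_elim (intro mult_nonneg_nonneg nn zero_le_power2)
  have Fnn: "F k \<ge> 0" for k unfolding F_def by (rule integral_nonneg_AE[OF AEF])
  have Gnn: "G k \<ge> 0" for k unfolding G_def by (intro Bochner_Integration.integral_nonneg) auto
  have err: "\<bar>F k - G k\<bar> \<le> s * G k + (\<integral>x. (u x)\<^sup>2 * (norm (grad (cutoff k) x))\<^sup>2 \<partial>lborel) / s"
    if "s > 0" for k s
    unfolding F_def G_def by (rule energy_error_bound[OF u that])
  have bdd': "(\<exists>M. \<forall>k. G k \<le> M) \<or> (\<exists>M. \<forall>k. F k \<le> M)"
    using bdd unfolding F_def G_def .
  obtain M where M: "\<And>k. G k \<le> M" and FG: "(\<lambda>k. F k - G k) \<longlonglongrightarrow> 0"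
    using perturbed_limit[OF Fnn Gnn cutoff_error_tendsto_0[OF n cu iu] err bdd'] by blast
  have eG: "ennreal (G k) = (\<integral>\<^sup>+x. ennreal ((cutoff k x)\<^sup>2 * (norm (grad u x))\<^sup>2) \<partial>lborel)" for k
    unfolding G_def by (intro nn_integral_eq_integral[symmetric] integrable_cutoff_sq_mult cg) auto
  have eF: "ennreal (F k) = (\<integral>\<^sup>+x. ennreal ((cutoff k x)\<^sup>2 * (u x * - laplacian u x)) \<partial>lborel)" for k
    unfolding F_def by (intro nn_integral_eq_integral[symmetric] integrable_cutoff_sq_mult cw AEF)
  have limG: "(\<lambda>k. ennreal (G k)) \<longlonglongrightarrow> (\<integral>\<^sup>+x. ennreal ((norm (grad u x))\<^sup>2) \<partial>lborel)"
    unfolding eG by (rule nn_integral_cutoff_tendsto[OF borel_measurable_off_origin[OF cg]]) auto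
  have limF: "(\<lambda>k. ennreal (F k)) \<longlonglongrightarrow> (\<integral>\<^sup>+x. ennreal (u x * - laplacian u x) \<partial>lborel)"
    unfolding eF by (rule nn_integral_cutoff_tendsto[OF borel_measurable_off_origin[OF cw] nn])
  have "(\<integral>\<^sup>+x. ennreal ((norm (grad u x))\<^sup>2) \<partial>lborel) \<le> ennreal M"
    using M by (intro LIMSEQ_le_const2[OF limG]) (auto intro!: ennreal_leI)
  then show fin: "(\<integral>\<^sup>+x. ennreal ((norm (grad u x))\<^sup>2) \<partial>lborel) < \<infinity>"
    using le_less_trans by fastforce
  then obtain A where A: "A \<ge> 0" "(\<integral>\<^sup>+x. ennreal ((norm (grad u x))\<^sup>2) \<partial>lborel) = ennreal A"
    by (cases "\<integral>\<^sup>+x. ennreal ((norm (grad u x))\<^sup>2) \<partial>lborel") auto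
  \<comment> \<open>The difference \<open>F k - G k\<close> lives in the reals, so the finite limit
    is brought back there before the two energies are compared.\<close>
  have "G \<longlonglongrightarrow> A"
    using limG Gnn A by (intro tendsto_ennrealD[of G]) auto
  then have "(\<lambda>k. G k + (F k - G k)) \<longlonglongrightarrow> A + 0"
    using FG by (rule tendsto_add)
  then have "(\<lambda>k. ennreal (F k)) \<longlonglongrightarrow> ennreal A"
    by (intro tendsto_ennrealI) simp
  then show "(\<integral>\<^sup>+x. ennreal ((norm (grad u x))\<^sup>2) \<partial>lborel) = (\<integral>\<^sup>+x. ennreal (u x * - laplacian u x) \<partial>lborel)"
    using limF LIMSEQ_unique A(2) by simp
qed

subsection \<open>The space \<open>\<D>\<^sup>1\<^sup>,\<^sup>2\<close>\<close>

lemma Lp_norm_pow_eq: "Lp_norm_pow p f = (\<integral>\<^sup>+x. ennreal (norm (f x) powr p) \<partial>lborel)"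
  by (simp add: Lp_norm_pow_def nn_integral_completion)

lemma Lp_norm_pow_2_eq: "Lp_norm_pow 2 f = (\<integral>\<^sup>+x. ennreal ((norm (f x))\<^sup>2) \<partial>lborel)"
  unfolding Lp_norm_pow_eq by (intro nn_integral_cong) (auto simp: powr_numeral)

lemma powr_add_le:
  fixes a b p :: real
  assumes "a \<ge> 0" "b \<ge> 0" "p \<ge> 0"
  shows "(a + b) powr p \<le> 2 powr p * (a powr p + b powr p)"
proof -
  have "(a + b) powr p \<le> (2 * max a b) powr p"
    using assms by (intro powr_mono2) auto
  also have "\<dots> = 2 powr p * max a b powr p" using assms by (simp add: powr_mult)
  also have "max a b powr p \<le> a powr p + b powr p" by (simp add: max_def)
  finally show ?thesis by simp
qed

lemma test_function_C1:
  fixes \<phi> :: "real^'n \<Rightarrow> real"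
  assumes "test_function \<phi>"
  shows "GDERIV \<phi> x :> grad \<phi> x" and "continuous_on UNIV \<phi>" and "continuous_on UNIV (grad \<phi>)"
    and "\<exists>R. \<forall>x. norm x \<ge> R \<longrightarrow> \<phi> x = 0 \<and> grad \<phi> x = 0"
proof -
  have 1: "Ck_on (Suc 0) UNIV \<phi>" using assms unfolding test_function_def by blast
  show D: "GDERIV \<phi> x :> grad \<phi> x" for x using Ck_on_SucD(1)[OF 1] by blast
  show "continuous_on UNIV \<phi>" by (rule Ck_on_imp_continuous_on[OF 1])
  show "continuous_on UNIV (grad \<phi>)"
    by (rule continuous_on_vecI) (rule Ck_on_imp_continuous_on[OF Ck_on_SucD(2)[OF 1]])
  have "bounded {x. \<phi> x \<noteq> 0}"
    using assms compact_imp_bounded bounded_subset closure_subset unfolding test_function_def by blast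
  then obtain B where B: "\<And>x. \<phi> x \<noteq> 0 \<Longrightarrow> norm x \<le> B"
    unfolding bounded_iff by auto
  have z: "\<phi> x = 0" if "norm x \<ge> B + 1" for x using B[of x] that by force
  have "grad \<phi> x = 0" if "norm x \<ge> B + 2" for x
    by (rule GDERIV_compact_support[OF D z]) (use that in auto)
  then show "\<exists>R. \<forall>x. norm x \<ge> R \<longrightarrow> \<phi> x = 0 \<and> grad \<phi> x = 0"
    using z by (intro exI[of _ "B + 2"]) auto
qed

lemma test_function_integrable:
  fixes \<phi> :: "real^'n \<Rightarrow> real"
  assumes "test_function \<phi>"
  shows "p > 0 \<Longrightarrow> integrable lborel (\<lambda>x. \<bar>\<phi> x\<bar> powr p)"
    and "integrable lborel (\<lambda>x. (norm (grad \<phi> x))\<^sup>2)"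
proof -
  obtain R where R: "\<And>x. norm x \<ge> R \<Longrightarrow> \<phi> x = 0 \<and> grad \<phi> x = 0"
    using test_function_C1(4)[OF assms] by blast
  show "integrable lborel (\<lambda>x. \<bar>\<phi> x\<bar> powr p)" if "p > 0"
    using that R
    by (intro integrable_compact_support[of _ R] continuous_on_powr' continuous_intros
        test_function_C1(2)[OF assms]) auto
  show "integrable lborel (\<lambda>x. (norm (grad \<phi> x))\<^sup>2)"
    using R by (intro integrable_compact_support[of _ R] continuous_intros test_function_C1(3)[OF assms]) auto
qed

lemma grad_diff_test_function:
  fixes \<phi> \<psi> :: "real^'n \<Rightarrow> real"
  assumes "test_function \<phi>" "test_function \<psi>"
  shows "grad (\<lambda>x. \<phi> x - \<psi> x) x = grad \<phi> x - grad \<psi> x"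
  by (rule GDERIV_imp_grad[OF GDERIV_diff[OF test_function_C1(1)[OF assms(1)] test_function_C1(1)[OF assms(2)]]])

section \<open>Bounds that follow from membership in D^{1,2}\<close>

lemma integrable_powr_diff:
  fixes f g :: "'a \<Rightarrow> real"
  assumes "integrable M (\<lambda>x. \<bar>f x\<bar> powr p)" "integrable M (\<lambda>x. \<bar>g x\<bar> powr p)" "p \<ge> 0"
    and [measurable]: "f \<in> borel_measurable M" "g \<in> borel_measurable M"
  shows "integrable M (\<lambda>x. \<bar>f x - g x\<bar> powr p)"
proof (rule Bochner_Integration.integrable_bound)
  show "integrable M (\<lambda>x. 2 powr p * (\<bar>f x\<bar> powr p + \<bar>g x\<bar> powr p))"
    using assms by simp
  have "\<bar>f x - g x\<bar> powr p \<le> 2 powr p * (\<bar>f x\<bar> powr p + \<bar>g x\<bar> powr p)" for x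
    using powr_mono2[of p "\<bar>f x - g x\<bar>" "\<bar>f x\<bar> + \<bar>g x\<bar>"] powr_add_le[of "\<bar>f x\<bar>" "\<bar>g x\<bar>" p] \<open>p \<ge> 0\<close>
    by (simp add: abs_triangle_ineq4)
  then show "AE x in M. norm (\<bar>f x - g x\<bar> powr p) \<le> norm (2 powr p * (\<bar>f x\<bar> powr p + \<bar>g x\<bar> powr p))"
    by (auto simp: order_trans[OF _ abs_ge_self])
qed simp

lemma finite_nn_integral_imp_integrable:
  fixes f :: "'a \<Rightarrow> real"
  assumes "f \<in> borel_measurable M" "\<And>x. f x \<ge> 0" "(\<integral>\<^sup>+x. ennreal (f x) \<partial>M) < \<infinity>"
  shows "integrable M f"
  using assms by (intro integrableI_nonneg) auto

text \<open>Discarding finitely many terms of a Cauchy sequence makes the energy bound uniform in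
  \<open>j\<close>. The gradients contribute nothing beyond this bound to part (1).\<close>

lemma D12_imp_bounds:
  fixes u :: "real^'n \<Rightarrow> real"
  assumes n: "CARD('n) \<ge> 3" and u: "u \<in> D12" and cu: "continuous_on UNIV u"
  defines "p \<equiv> 2 * real CARD('n) / (real CARD('n) - 2)"
  obtains \<phi> M where "integrable lborel (\<lambda>x. \<bar>u x\<bar> powr p)"
    "\<And>j. test_function (\<phi> j)" "(\<lambda>j. \<integral>x. \<bar>\<phi> j x - u x\<bar> powr p \<partial>lborel) \<longlonglongrightarrow> 0"
    "\<And>j. integrable lborel (\<lambda>x. \<bar>\<phi> j x - u x\<bar> powr p)"
    "\<And>j. (\<integral>x. (norm (grad (\<phi> j) x))\<^sup>2 \<partial>lborel) \<le> M"
proof -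
  have p: "p > 1" using n by (simp add: p_def field_simps)
  have mu: "u \<in> borel_measurable borel" by (rule borel_measurable_continuous_onI[OF cu])
  obtain \<phi>0 where t0: "\<And>k. test_function (\<phi>0 k)"
    and cau: "\<And>\<epsilon>. \<epsilon> > 0 \<Longrightarrow> \<exists>N. \<forall>j\<ge>N. \<forall>k\<ge>N. Lp_norm_pow 2 (grad (\<lambda>x. \<phi>0 j x - \<phi>0 k x)) < ennreal \<epsilon>"
    and lim0: "(\<lambda>k. Lp_norm_pow p (\<lambda>x. \<phi>0 k x - u x)) \<longlonglongrightarrow> 0"
    using u unfolding D12_def p_def by blast
  have m0: "\<phi>0 k \<in> borel_measurable borel" for k
    by (rule borel_measurable_continuous_onI[OF test_function_C1(2)[OF t0]])
  note [measurable] = mu m0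
  obtain N where N: "\<And>j k. j \<ge> N \<Longrightarrow> k \<ge> N \<Longrightarrow> Lp_norm_pow 2 (grad (\<lambda>x. \<phi>0 j x - \<phi>0 k x)) < ennreal 1"
    using cau[of 1] by auto
  have "\<forall>\<^sub>F k in sequentially. Lp_norm_pow p (\<lambda>x. \<phi>0 k x - u x) < 1"
    using lim0 by (rule order_tendstoD) simp
  then obtain m where m: "Lp_norm_pow p (\<lambda>x. \<phi>0 m x - u x) < 1"
    using eventually_happens by fastforce
  have im: "integrable lborel (\<lambda>x. \<bar>\<phi>0 m x - u x\<bar> powr p)"
    using m less_trans[OF m, of \<infinity>] by (intro finite_nn_integral_imp_integrable) (auto simp: Lp_norm_pow_eq)
  \<comment> \<open>\<open>u\<close> is recovered from a single test function at finite L^p distance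
    from it.\<close>
  have "integrable lborel (\<lambda>x. \<bar>\<phi>0 m x - (\<phi>0 m x - u x)\<bar> powr p)"
    using p by (intro integrable_powr_diff test_function_integrable(1)[OF t0] im) auto
  then have iu: "integrable lborel (\<lambda>x. \<bar>u x\<bar> powr p)" by simp
  have id: "integrable lborel (\<lambda>x. \<bar>\<phi>0 j x - u x\<bar> powr p)" for j
    using p by (intro integrable_powr_diff test_function_integrable(1)[OF t0] iu) auto
  have "ennreal (\<integral>x. \<bar>\<phi>0 j x - u x\<bar> powr p \<partial>lborel) = Lp_norm_pow p (\<lambda>x. \<phi>0 j x - u x)" for j
    unfolding Lp_norm_pow_eq by (subst nn_integral_eq_integral) (use id in auto)
  then have "(\<lambda>j. ennreal (\<integral>x. \<bar>\<phi>0 j x - u x\<bar> powr p \<partial>lborel)) \<longlonglongrightarrow> ennreal 0"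
    using lim0 by simp
  then have lim: "(\<lambda>j. \<integral>x. \<bar>\<phi>0 j x - u x\<bar> powr p \<partial>lborel) \<longlonglongrightarrow> 0"
    by (rule tendsto_ennrealD) auto
  \<comment> \<open>From |a|^2 \<le> 2 |b|^2 + 2 |a - b|^2, with b the gradient at index
    \<open>N\<close>, from which all later gradients have squared distance at most 1.\<close>
  define M where "M = 2 * (\<integral>x. (norm (grad (\<phi>0 N) x))\<^sup>2 \<partial>lborel) + 2"
  have bd: "(\<integral>x. (norm (grad (\<phi>0 j) x))\<^sup>2 \<partial>lborel) \<le> M" if "j \<ge> N" for j
  proof -
    let ?d = "\<lambda>x. (norm (grad (\<phi>0 j) x - grad (\<phi>0 N) x))\<^sup>2"
    have cd: "continuous_on UNIV ?d"
      by (intro continuous_intros test_function_C1(3)[OF t0])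
    have e: "(\<integral>\<^sup>+x. ennreal (?d x) \<partial>lborel) < ennreal 1"
      using N[OF that order_refl] by (simp add: Lp_norm_pow_2_eq grad_diff_test_function[OF t0 t0])
    have i: "integrable lborel ?d"
      using e by (intro finite_nn_integral_imp_integrable borel_measurable_continuous_onI[OF cd, simplified])
        (auto intro: borel_measurable_continuous_onI[OF cd] less_trans[OF e])
    have "ennreal (\<integral>x. ?d x \<partial>lborel) < ennreal 1"
      using e i by (subst (asm) nn_integral_eq_integral) auto
    then have d1: "(\<integral>x. ?d x \<partial>lborel) \<le> 1" by (simp add: ennreal_less_iff)
    have pt: "(norm (grad (\<phi>0 j) x))\<^sup>2 \<le> 2 * (norm (grad (\<phi>0 N) x))\<^sup>2 + 2 * ?d x" for x
      using norm_triangle_sub[of "grad (\<phi>0 j) x" "grad (\<phi>0 N) x"]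
        power_mono[of "norm (grad (\<phi>0 j) x)" "norm (grad (\<phi>0 N) x) + norm (grad (\<phi>0 j) x - grad (\<phi>0 N) x)" 2]
        sum_squares_bound[of "norm (grad (\<phi>0 N) x)" "norm (grad (\<phi>0 j) x - grad (\<phi>0 N) x)"]
      by (simp add: power2_sum)
    have "(\<integral>x. (norm (grad (\<phi>0 j) x))\<^sup>2 \<partial>lborel) \<le> (\<integral>x. 2 * (norm (grad (\<phi>0 N) x))\<^sup>2 + 2 * ?d x \<partial>lborel)"
      using i test_function_integrable(2)[OF t0] by (intro integral_mono pt) simp_all
    also have "\<dots> = 2 * (\<integral>x. (norm (grad (\<phi>0 N) x))\<^sup>2 \<partial>lborel) + 2 * (\<integral>x. ?d x \<partial>lborel)"
      using i test_function_integrable(2)[OF t0[of N]] by simp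
    finally show ?thesis using d1 by (simp add: M_def)
  qed
  show ?thesis
  proof (rule that[of "\<lambda>j. \<phi>0 (j + N)" M, OF iu])
    show "(\<lambda>j. \<integral>x. \<bar>\<phi>0 (j + N) x - u x\<bar> powr p \<partial>lborel) \<longlonglongrightarrow> 0"
      using lim by (rule LIMSEQ_ignore_initial_segment)
  qed (auto intro: t0 id bd)
qed

text \<open>In place of Hoelder's inequality: |f| \<le> s + s^(1-p) |f|^p holds both for |f| below
  and for |f| above s. The first term costs a multiple of the volume of a ball, the second vanishes
  in the limit.\<close>

lemma integral_against_compact_support_tendsto_0:
  fixes f :: "nat \<Rightarrow> real^'n \<Rightarrow> real" and \<kappa> :: "real^'n \<Rightarrow> real"
  assumes p: "p > 1" and c: "continuous_on UNIV \<kappa>" and supp: "\<And>x. norm x \<ge> R \<Longrightarrow> \<kappa> x = 0"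
    and i: "\<And>j. integrable lborel (\<lambda>x. \<bar>f j x\<bar> powr p)" and m: "\<And>j. continuous_on UNIV (f j)"
    and lim: "(\<lambda>j. \<integral>x. \<bar>f j x\<bar> powr p \<partial>lborel) \<longlonglongrightarrow> 0"
  shows "(\<lambda>j. \<integral>x. f j x * \<kappa> x \<partial>lborel) \<longlonglongrightarrow> 0"
proof (rule tendsto_0_by_two_scales[OF _ lim])
  fix \<epsilon> :: real assume "\<epsilon> > 0"
  obtain C where C: "C > 0" "\<And>x. norm (\<kappa> x) \<le> C"
    using bounded_compact_support[OF c supp] by metis
  define V where "V = measure lborel (ball (0::real^'n) R)"
  \<comment> \<open>Chosen so that \<open>C * s * V \<le> \<epsilon>\<close>; the added 1 keeps the
    denominator positive when the ball is empty.\<close>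
  define s where "s = \<epsilon> / (C * (V + 1))"
  have V: "V \<ge> 0" by (simp add: V_def)
  have s: "s > 0" using \<open>\<epsilon> > 0\<close> C V by (simp add: s_def)
  have "C * s * V \<le> C * s * (V + 1)" using C s by simp
  also have "\<dots> = \<epsilon>" using C V by (simp add: s_def)
  finally have sV: "C * s * V \<le> \<epsilon>" .
  have pt: "\<bar>f j x * \<kappa> x\<bar> \<le> C * s * indicator (ball 0 R) x + C * s powr (1 - p) * \<bar>f j x\<bar> powr p" for j x
  proof (cases "norm x < R")
    case True
    have "\<bar>f j x\<bar> \<le> s + s powr (1 - p) * \<bar>f j x\<bar> powr p"
    proof (cases "\<bar>f j x\<bar> \<le> s")
      case False
      have "\<bar>f j x\<bar> = s powr (1 - p) * (s powr (p - 1) * \<bar>f j x\<bar>)"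
        using s by (simp add: mult.assoc[symmetric] powr_add[symmetric])
      also have "\<dots> \<le> s powr (1 - p) * (\<bar>f j x\<bar> powr (p - 1) * \<bar>f j x\<bar>)"
        using False s p by (intro mult_left_mono mult_right_mono powr_mono2) auto
      also have "\<bar>f j x\<bar> powr (p - 1) * \<bar>f j x\<bar> = \<bar>f j x\<bar> powr p"
        using False s by (simp add: powr_mult_base[symmetric] powr_diff)
      finally show ?thesis using s by simp
    qed (use s in \<open>simp add: add_increasing2\<close>)
    then have "\<bar>f j x\<bar> * \<bar>\<kappa> x\<bar> \<le> (s + s powr (1 - p) * \<bar>f j x\<bar> powr p) * C"
      using C(2)[of x] by (intro mult_mono) auto
    then show ?thesis using True by (simp add: abs_mult algebra_simps)
  next
    case False
    then show ?thesis using supp[of x] C(1) by simp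
  qed
  have ib: "integrable lborel (\<lambda>x. indicator (ball (0::real^'n) R) x :: real)"
    by (rule integrable_indicator_bounded) auto
  have "\<bar>\<integral>x. f j x * \<kappa> x \<partial>lborel\<bar> \<le> \<epsilon> + C * s powr (1 - p) * (\<integral>x. \<bar>f j x\<bar> powr p \<partial>lborel)" for j
  proof -
    have fi: "integrable lborel (\<lambda>x. f j x * \<kappa> x)"
      by (rule integrable_compact_support[of _ R]) (auto intro!: continuous_intros m c supp)
    have "\<bar>\<integral>x. f j x * \<kappa> x \<partial>lborel\<bar> \<le> (\<integral>x. \<bar>f j x * \<kappa> x\<bar> \<partial>lborel)" by (rule integral_abs_bound)
    also have "\<dots> \<le> (\<integral>x. C * s * indicator (ball 0 R) x + C * s powr (1 - p) * \<bar>f j x\<bar> powr p \<partial>lborel)"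
      using fi i ib by (intro integral_mono pt Bochner_Integration.integrable_add integrable_mult_right) auto
    also have "\<dots> = C * s * V + C * s powr (1 - p) * (\<integral>x. \<bar>f j x\<bar> powr p \<partial>lborel)"
      using i ib by (simp add: V_def)
    finally show ?thesis using sV by simp
  qed
  then show "\<exists>C. \<forall>j. \<bar>\<integral>x. f j x * \<kappa> x \<partial>lborel\<bar> \<le> \<epsilon> + C * (\<integral>x. \<bar>f j x\<bar> powr p \<partial>lborel)"
    by blast
qed

text \<open>Green's identity with \<open>f = \<phi> j - u\<close> shows that the pairing of
  \<open>grad (\<phi> j)\<close> with \<eta>^2 grad u equals \<open>G + I j\<close>, where
  \<open>I j\<close> tends to zero. Cauchy-Schwarz bounds the pairing by
  \<open>M / 2 + G / 2\<close>. As \<open>G\<close> is finite for a fixed cutoff, half of it can be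
  absorbed, which leaves \<open>G \<le> M\<close> with \<open>M\<close> independent of
  \<open>k\<close>.\<close>

lemma D12_imp_cutoff_energy_bounded:
  fixes u :: "real^'n \<Rightarrow> real"
  assumes n: "CARD('n) \<ge> 3" and u: "C2_off_origin u" and D12: "u \<in> D12"
  shows "\<exists>M. \<forall>k. (\<integral>x. (cutoff k x)\<^sup>2 * (norm (grad u x))\<^sup>2 \<partial>lborel) \<le> M"
proof -
  note D = C2_off_origin_GDERIV[OF u]
  have cu: "continuous_on UNIV u" using u by (simp add: C2_off_origin_def)
  define p where "p = 2 * real CARD('n) / (real CARD('n) - 2)"
  have p: "p > 1" using n by (simp add: p_def field_simps)
  obtain \<phi> M where "integrable lborel (\<lambda>x. \<bar>u x\<bar> powr p)" and t: "\<And>j. test_function (\<phi> j)"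
    and lim: "(\<lambda>j. \<integral>x. \<bar>\<phi> j x - u x\<bar> powr p \<partial>lborel) \<longlonglongrightarrow> 0"
    and id: "\<And>j. integrable lborel (\<lambda>x. \<bar>\<phi> j x - u x\<bar> powr p)"
    and bd: "\<And>j. (\<integral>x. (norm (grad (\<phi> j) x))\<^sup>2 \<partial>lborel) \<le> M"
    by (rule D12_imp_bounds[OF n D12 cu, folded p_def]) (rule that)
  have "(\<integral>x. (cutoff k x)\<^sup>2 * (norm (grad u x))\<^sup>2 \<partial>lborel) \<le> M" for k
  proof -
    let ?\<eta> = "cutoff k :: real^'n \<Rightarrow> real" and ?D\<eta> = "grad (cutoff k) :: real^'n \<Rightarrow> real^'n"
    define G where "G = (\<integral>x. (?\<eta> x)\<^sup>2 * (norm (grad u x))\<^sup>2 \<partial>lborel)"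
    have iG: "integrable lborel (\<lambda>x. (?\<eta> x)\<^sup>2 * (norm (grad u x))\<^sup>2)"
      by (intro integrable_cutoff_sq_mult continuous_intros D(2))
    \<comment> \<open>\<open>\<kappa>\<close> is minus the divergence of \<eta>^2 grad u. It is
      continuous with compact support, so L^p convergence of \<open>\<phi> j\<close> to
      \<open>u\<close> is enough for \<open>I j\<close> to vanish in the limit.\<close>
    define \<kappa> where "\<kappa> x = ?\<eta> x *\<^sub>R (?\<eta> x * - laplacian u x - 2 * (?D\<eta> x \<bullet> grad u x))" for x
    have c\<kappa>: "continuous_on UNIV \<kappa>"
      unfolding \<kappa>_def
      by (intro continuous_on_cutoff_scaleR continuous_intros continuous_on_cutoff
          continuous_on_laplacian[OF u] continuous_on_subset[OF continuous_on_grad_cutoff] D(2)) auto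
    have s\<kappa>: "\<kappa> x = 0" if "norm x \<ge> 2 * real (Suc k)" for x
      using cutoff_eq_0_far[OF that] by (simp add: \<kappa>_def)
    define I where "I j = (\<integral>x. (\<phi> j x - u x) * \<kappa> x \<partial>lborel)" for j
    have I0: "I \<longlonglongrightarrow> 0"
      unfolding I_def
      by (rule integral_against_compact_support_tendsto_0[OF p c\<kappa> s\<kappa> id _ lim])
        (auto intro!: continuous_intros cu test_function_C1(2)[OF t])
    have ic: "integrable lborel (\<lambda>x. (?\<eta> x)\<^sup>2 * (grad (\<phi> j) x \<bullet> grad u x))" for j
      by (intro integrable_cutoff_sq_mult continuous_intros D(2)
          continuous_on_subset[OF test_function_C1(3)[OF t]]) auto
    have key: "(\<integral>x. (?\<eta> x)\<^sup>2 * (grad (\<phi> j) x \<bullet> grad u x) \<partial>lborel) = G + I j" for j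
    proof -
      let ?f = "\<lambda>x. \<phi> j x - u x" and ?Df = "\<lambda>x. grad (\<phi> j) x - grad u x"
      have cf: "continuous_on (- {0}) ?f"
        by (intro continuous_intros continuous_on_subset[OF test_function_C1(2)[OF t]]
            continuous_on_subset[OF cu]) auto
      have "continuous_on (- {0}) (\<lambda>x. 2 * (?f x * (?D\<eta> x \<bullet> grad u x)))"
        by (intro continuous_intros cf D(2) continuous_on_subset[OF continuous_on_grad_cutoff]) auto
      from integrable_cutoff_mult[OF this, of k]
      have i2: "integrable lborel (\<lambda>x. 2 * ?\<eta> x * (?f x * (?D\<eta> x \<bullet> grad u x)))"
        by (simp only: mult.left_commute mult.commute mult.assoc)
      have i3: "integrable lborel (\<lambda>x. (?\<eta> x)\<^sup>2 * (?f x * - laplacian u x))"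
        by (intro integrable_cutoff_sq_mult continuous_intros cf continuous_on_laplacian[OF u])
      have "(\<integral>x. (?\<eta> x)\<^sup>2 * (?Df x \<bullet> grad u x) \<partial>lborel)
          + (\<integral>x. 2 * ?\<eta> x * (?f x * (?D\<eta> x \<bullet> grad u x)) \<partial>lborel)
          = (\<integral>x. (?\<eta> x)\<^sup>2 * (?f x * - laplacian u x) \<partial>lborel)"
      proof (rule green_identity_cutoff[OF u])
        show "GDERIV ?f x :> ?Df x" if "x \<noteq> 0" for x
          by (rule GDERIV_diff[OF test_function_C1(1)[OF t] D(1)[OF that]])
        show "continuous_on (- {0}) ?Df"
          by (intro continuous_intros D(2) continuous_on_subset[OF test_function_C1(3)[OF t]]) auto
      qed
      moreover have "(\<integral>x. (?\<eta> x)\<^sup>2 * (?Df x \<bullet> grad u x) \<partial>lborel)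
          = (\<integral>x. (?\<eta> x)\<^sup>2 * (grad (\<phi> j) x \<bullet> grad u x) \<partial>lborel) - G"
      proof -
        have "(?\<eta> x)\<^sup>2 * (?Df x \<bullet> grad u x)
            = (?\<eta> x)\<^sup>2 * (grad (\<phi> j) x \<bullet> grad u x) - (?\<eta> x)\<^sup>2 * (norm (grad u x))\<^sup>2" for x
          by (simp add: inner_diff_left power2_norm_eq_inner right_diff_distrib)
        then show ?thesis using ic iG by (simp add: G_def)
      qed
      moreover have "I j = (\<integral>x. (?\<eta> x)\<^sup>2 * (?f x * - laplacian u x) \<partial>lborel)
          - (\<integral>x. 2 * ?\<eta> x * (?f x * (?D\<eta> x \<bullet> grad u x)) \<partial>lborel)"
      proof -
        have "?f x * \<kappa> x = (?\<eta> x)\<^sup>2 * (?f x * - laplacian u x) - 2 * ?\<eta> x * (?f x * (?D\<eta> x \<bullet> grad u x))" for x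
          by (simp add: \<kappa>_def power2_eq_square algebra_simps)
        then show ?thesis
          unfolding I_def using Bochner_Integration.integral_diff[OF i3 i2] by simp
      qed
      ultimately show ?thesis by simp
    qed
    have "G + I j \<le> M / 2 + G / 2" for j
    proof -
      have pt: "(?\<eta> x)\<^sup>2 * (grad (\<phi> j) x \<bullet> grad u x)
          \<le> (norm (grad (\<phi> j) x))\<^sup>2 / 2 + (?\<eta> x)\<^sup>2 * (norm (grad u x))\<^sup>2 / 2" for x
      proof -
        define a where "a = norm (grad (\<phi> j) x)"
        define b where "b = norm (grad u x)"
        have \<eta>: "0 \<le> (?\<eta> x)\<^sup>2" "(?\<eta> x)\<^sup>2 \<le> 1" using cutoff_range[of k x] by (auto simp: power_le_one)
        have "grad (\<phi> j) x \<bullet> grad u x \<le> a * b" unfolding a_def b_def by (rule norm_cauchy_schwarz)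
        also have "a * b \<le> a\<^sup>2 / 2 + b\<^sup>2 / 2" using sum_squares_bound[of a b] by simp
        finally have "(?\<eta> x)\<^sup>2 * (grad (\<phi> j) x \<bullet> grad u x) \<le> (?\<eta> x)\<^sup>2 * (a\<^sup>2 / 2 + b\<^sup>2 / 2)"
          using \<eta>(1) by (intro mult_left_mono)
        also have "\<dots> = (?\<eta> x)\<^sup>2 * (a\<^sup>2 / 2) + (?\<eta> x)\<^sup>2 * b\<^sup>2 / 2" by (simp add: distrib_left)
        also have "(?\<eta> x)\<^sup>2 * (a\<^sup>2 / 2) \<le> a\<^sup>2 / 2" using \<eta> by (intro mult_left_le_one_le) auto
        finally show ?thesis by (simp add: a_def b_def)
      qed
      have ia: "integrable lborel (\<lambda>x. (norm (grad (\<phi> j) x))\<^sup>2)"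
        by (rule test_function_integrable(2)[OF t])
      have "G + I j \<le> (\<integral>x. (norm (grad (\<phi> j) x))\<^sup>2 / 2 + (?\<eta> x)\<^sup>2 * (norm (grad u x))\<^sup>2 / 2 \<partial>lborel)"
        unfolding key[symmetric] using ia iG by (intro integral_mono ic pt) simp
      also have "\<dots> = (\<integral>x. (norm (grad (\<phi> j) x))\<^sup>2 \<partial>lborel) / 2 + G / 2"
        using ia iG by (simp add: G_def)
      finally show ?thesis using bd[of j] by simp
    qed
    \<comment> \<open>Here \<open>j\<close> tends to infinity while the cutoff stays fixed.\<close>
    then have "G + 0 \<le> M / 2 + G / 2"
      by (intro LIMSEQ_le_const2[OF tendsto_add[OF tendsto_const I0]]) auto
    then show ?thesis by (simp add: G_def)
  qed
  then show ?thesis by blast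
qed

section \<open>Finite energy implies membership in D^{1,2}\<close>

text \<open>Uniform closeness on a common ball becomes closeness of integrals. Since
  \<open>\<epsilon> \<le> 1\<close>, both \<open>\<epsilon> powr p\<close> and
  \<open>\<epsilon>\<^sup>2\<close> are at most \<open>\<epsilon>\<close>, so the single bound
  \<open>\<epsilon> * V\<close> serves the function and the gradient.\<close>

lemma Lp_approx_by_test_function:
  fixes v :: "real^'n \<Rightarrow> real"
  assumes D: "\<And>x. GDERIV v x :> Dv x" and cDv: "continuous_on UNIV Dv"
    and supp: "\<And>x. norm x \<ge> R \<Longrightarrow> v x = 0" and \<delta>: "\<delta> > 0" and p: "p \<ge> 1"
  obtains \<phi> where "test_function \<phi>" "(\<integral>\<^sup>+x. ennreal (\<bar>\<phi> x - v x\<bar> powr p) \<partial>lborel) \<le> ennreal \<delta>"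
    "(\<integral>\<^sup>+x. ennreal ((norm (grad \<phi> x - Dv x))\<^sup>2) \<partial>lborel) \<le> ennreal \<delta>"
proof -
  \<comment> \<open>Large enough to contain the supports of \<open>v\<close>, of its mollification
    (radius \<open>R + 1\<close>) and of both gradients.\<close>
  define B where "B = cball (0::real^'n) (R + 2)"
  define V where "V = measure lborel B"
  have V: "V \<ge> 0" "emeasure lborel B = ennreal V"
    using emeasure_bounded_finite[of B]
    by (auto simp: V_def B_def emeasure_eq_ennreal_measure less_top[symmetric])
  define \<epsilon> where "\<epsilon> = min 1 (\<delta> / (V + 1))"
  have \<epsilon>: "0 < \<epsilon>" "\<epsilon> \<le> 1" "\<epsilon> * V \<le> \<delta>"
  proof -
    have "\<epsilon> * V \<le> \<delta> / (V + 1) * (V + 1)"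
      using V \<delta> by (intro mult_mono) (auto simp: \<epsilon>_def)
    then show "\<epsilon> * V \<le> \<delta>" using V by simp
  qed (use V \<delta> in \<open>auto simp: \<epsilon>_def\<close>)
  obtain \<phi> where \<phi>: "test_function \<phi>" "\<And>x. \<bar>\<phi> x - v x\<bar> \<le> \<epsilon>"
    "\<And>x. norm (grad \<phi> x - Dv x) \<le> \<epsilon>" "\<And>x. norm x \<ge> R + 1 \<Longrightarrow> \<phi> x = 0"
    using C1_approx_by_test_function[OF D cDv supp \<epsilon>(1)] by blast
  have bound: "(\<integral>\<^sup>+x. ennreal (h x) \<partial>lborel) \<le> ennreal \<delta>"
    if "\<And>x. h x \<le> \<epsilon>" "\<And>x. x \<notin> B \<Longrightarrow> h x = 0" for h :: "real^'n \<Rightarrow> real"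
  proof -
    have "(\<integral>\<^sup>+x. ennreal (h x) \<partial>lborel) \<le> (\<integral>\<^sup>+x. ennreal \<epsilon> * indicator B x \<partial>lborel)"
      using that by (intro nn_integral_mono) (auto simp: indicator_def intro: ennreal_leI)
    also have "\<dots> = ennreal \<epsilon> * emeasure lborel B"
      by (rule nn_integral_cmult_indicator) (simp add: B_def)
    also have "\<dots> = ennreal (\<epsilon> * V)" using V \<epsilon> by (simp add: ennreal_mult)
    finally show ?thesis using \<epsilon>(3) ennreal_leI order_trans by blast
  qed
  have z: "\<phi> x = 0" "v x = 0" "grad \<phi> x = 0" "Dv x = 0" if "x \<notin> B" for x
    using that \<phi>(4)[of x] supp[of x] GDERIV_compact_support[OF test_function_C1(1)[OF \<phi>(1)] \<phi>(4), where x=x]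
      GDERIV_compact_support[OF D supp, where x=x] by (auto simp: B_def)
  show ?thesis
  proof (rule that[OF \<phi>(1)])
    show "(\<integral>\<^sup>+x. ennreal (\<bar>\<phi> x - v x\<bar> powr p) \<partial>lborel) \<le> ennreal \<delta>"
    proof (rule bound)
      fix x
      have "\<bar>\<phi> x - v x\<bar> powr p \<le> \<epsilon> powr p" using \<phi>(2) p by (intro powr_mono2) auto
      also have "\<dots> \<le> \<epsilon> powr 1" using \<epsilon> p by (intro powr_mono') auto
      finally show "\<bar>\<phi> x - v x\<bar> powr p \<le> \<epsilon>" using \<epsilon> by simp
    qed (simp add: z)
    show "(\<integral>\<^sup>+x. ennreal ((norm (grad \<phi> x - Dv x))\<^sup>2) \<partial>lborel) \<le> ennreal \<delta>"
    proof (rule bound)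
      fix x
      have "(norm (grad \<phi> x - Dv x))\<^sup>2 \<le> \<epsilon>\<^sup>2" using \<phi>(3) by (intro power_mono) auto
      also have "\<dots> \<le> \<epsilon> ^ 1" using \<epsilon> by (intro power_decreasing) auto
      finally show "(norm (grad \<phi> x - Dv x))\<^sup>2 \<le> \<epsilon>" by simp
    qed (simp add: z)
  qed
qed

text \<open>The approximating functions are mollified truncations \<eta>_k u. Their gradient error
  splits into the mollification error, the part of \<open>grad u\<close> that is cut off, and the
  term with \<open>grad (cutoff k)\<close>, whose decay is \<open>cutoff_error_tendsto_0\<close>.
  The Cauchy property holds because all gradients converge to \<open>grad u\<close> in L^2.\<close>

lemma D12I:
  fixes u :: "real^'n \<Rightarrow> real"
  assumes n: "CARD('n) \<ge> 3" and u: "C2_off_origin u"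
    and iu: "integrable lborel (\<lambda>x. \<bar>u x\<bar> powr (2 * real CARD('n) / (real CARD('n) - 2)))"
    and ig: "integrable lborel (\<lambda>x. (norm (grad u x))\<^sup>2)"
  shows "u \<in> D12"
proof -
  note D = C2_off_origin_GDERIV[OF u]
  have cu: "continuous_on UNIV u" using u by (simp add: C2_off_origin_def)
  define p where "p = 2 * real CARD('n) / (real CARD('n) - 2)"
  have p: "p > 1" using n by (simp add: p_def field_simps)
  have [measurable]: "u \<in> borel_measurable borel" by (rule borel_measurable_continuous_onI[OF cu])
  have [measurable]: "grad u \<in> borel_measurable borel" by (rule borel_measurable_off_origin[OF D(2)])
  have [measurable]: "cutoff k \<in> borel_measurable (borel :: (real^'n) measure)" for k :: nat
    by (rule borel_measurable_continuous_onI[OF continuous_on_cutoff])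
  have [measurable]: "grad (cutoff k) \<in> borel_measurable (borel :: (real^'n) measure)" for k :: nat
    by (rule borel_measurable_continuous_onI[OF continuous_on_grad_cutoff])
  define \<delta> where "\<delta> k = inverse (real (Suc k))" for k
  have \<delta>: "\<delta> k > 0" for k by (simp add: \<delta>_def)
  have \<delta>0: "\<delta> \<longlonglongrightarrow> 0" unfolding \<delta>_def[abs_def] by (rule LIMSEQ_inverse_real_of_nat)
  define Dv where "Dv k x = cutoff k x *\<^sub>R grad u x + u x *\<^sub>R grad (cutoff k) x" for k x
  have "\<exists>\<phi>. test_function \<phi> \<and> (\<integral>\<^sup>+x. ennreal (\<bar>\<phi> x - cutoff k x * u x\<bar> powr p) \<partial>lborel) \<le> ennreal (\<delta> k)
    \<and> (\<integral>\<^sup>+x. ennreal ((norm (grad \<phi> x - Dv k x))\<^sup>2) \<partial>lborel) \<le> ennreal (\<delta> k)" for k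
  proof -
    have 1: "GDERIV (\<lambda>x. cutoff k x * u x) x :> Dv k x" for x
      unfolding Dv_def by (rule GDERIV_cutoff_mult[OF D(1)])
    have 2: "continuous_on UNIV (Dv k)"
      unfolding Dv_def by (rule continuous_on_grad_cutoff_mult[OF D(1) D(2)])
    have 3: "cutoff k x * u x = 0" if "norm x \<ge> 2 * real (Suc k)" for x
      using cutoff_eq_0_far[OF that] by simp
    show ?thesis
      by (rule Lp_approx_by_test_function[OF 1 2 3 \<delta>[of k] less_imp_le[OF p]]) (assumption, intro exI conjI)
  qed
  from choice[OF allI[OF this]] obtain \<phi> where all: "\<forall>k. test_function (\<phi> k)
    \<and> (\<integral>\<^sup>+x. ennreal (\<bar>\<phi> k x - cutoff k x * u x\<bar> powr p) \<partial>lborel) \<le> ennreal (\<delta> k)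
    \<and> (\<integral>\<^sup>+x. ennreal ((norm (grad (\<phi> k) x - Dv k x))\<^sup>2) \<partial>lborel) \<le> ennreal (\<delta> k)" ..
  have \<phi>: "test_function (\<phi> k)"
    "(\<integral>\<^sup>+x. ennreal (\<bar>\<phi> k x - cutoff k x * u x\<bar> powr p) \<partial>lborel) \<le> ennreal (\<delta> k)"
    "(\<integral>\<^sup>+x. ennreal ((norm (grad (\<phi> k) x - Dv k x))\<^sup>2) \<partial>lborel) \<le> ennreal (\<delta> k)" for k
    by (rule conjunct1[OF spec[OF all]] conjunct1[OF conjunct2[OF spec[OF all]]]
        conjunct2[OF conjunct2[OF spec[OF all]]])+
  have [measurable]: "\<phi> k \<in> borel_measurable borel" "grad (\<phi> k) \<in> borel_measurable borel" for k
    using borel_measurable_continuous_onI test_function_C1(2,3)[OF \<phi>(1)] by blast+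
  have [measurable]: "Dv k \<in> borel_measurable borel" for k
    unfolding Dv_def[abs_def] by measurable
  have iu': "integrable lborel (\<lambda>x. \<bar>u x\<bar> powr p)" using iu by (simp add: p_def)
  have AE0: "AE x in lborel. x \<noteq> (0::real^'n)" by (rule AE_lborel_singleton)

  \<comment> \<open>\<open>a\<close>, \<open>b\<close> and \<open>E\<close> measure the three
    effects of truncation: lost L^p mass, lost gradient energy, and the gradient of the cutoff
    itself.\<close>
  define a where "a k = (\<integral>x. \<bar>(cutoff k x - 1) * u x\<bar> powr p \<partial>lborel)" for k
  have r1: "\<bar>cutoff k x - 1\<bar> \<le> 1" for k and x :: "real^'n" using cutoff_range[of k x] by simp
  have ale: "\<bar>(cutoff k x - 1) * u x\<bar> powr p \<le> \<bar>u x\<bar> powr p" for k x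
    using p r1[of k x] by (intro powr_mono2) (auto simp: abs_mult intro: mult_left_le_one_le)
  have ia: "integrable lborel (\<lambda>x. \<bar>(cutoff k x - 1) * u x\<bar> powr p)" for k
    using ale by (intro Bochner_Integration.integrable_bound[OF iu']) auto
  have "a \<longlonglongrightarrow> (\<integral>x. 0 \<partial>(lborel :: (real^'n) measure))"
    unfolding a_def[abs_def]
  proof (rule integral_dominated_convergence[where w="\<lambda>x. \<bar>u x\<bar> powr p"])
    show "AE x in lborel. (\<lambda>k. \<bar>(cutoff k x - 1) * u x\<bar> powr p) \<longlonglongrightarrow> 0"
      using AE0
    proof eventually_elim
      fix x :: "real^'n" assume "x \<noteq> 0"
      from cutoff_eventually_1[OF this]
      have "\<forall>\<^sub>F k in sequentially. \<bar>(cutoff k x - 1) * u x\<bar> powr p = 0"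
        by eventually_elim simp
      then show "(\<lambda>k. \<bar>(cutoff k x - 1) * u x\<bar> powr p) \<longlonglongrightarrow> 0" by (rule tendsto_eventually)
    qed
  qed (use iu' ale in auto)
  then have a0: "a \<longlonglongrightarrow> 0" by simp

  define b where "b k = (\<integral>x. (cutoff k x - 1)\<^sup>2 * (norm (grad u x))\<^sup>2 \<partial>lborel)" for k
  have ble: "(cutoff k x - 1)\<^sup>2 * (norm (grad u x))\<^sup>2 \<le> (norm (grad u x))\<^sup>2" for k x
    using r1[of k x] by (intro mult_left_le_one_le) (auto simp: abs_le_square_iff[of _ "1::real", simplified])
  have ib: "integrable lborel (\<lambda>x. (cutoff k x - 1)\<^sup>2 * (norm (grad u x))\<^sup>2)" for k
    using ble by (intro Bochner_Integration.integrable_bound[OF ig]) auto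
  have "b \<longlonglongrightarrow> (\<integral>x. 0 \<partial>(lborel :: (real^'n) measure))"
    unfolding b_def[abs_def]
  proof (rule integral_dominated_convergence[where w="\<lambda>x. (norm (grad u x))\<^sup>2"])
    show "AE x in lborel. (\<lambda>k. (cutoff k x - 1)\<^sup>2 * (norm (grad u x))\<^sup>2) \<longlonglongrightarrow> 0"
      using AE0
    proof eventually_elim
      fix x :: "real^'n" assume "x \<noteq> 0"
      from cutoff_eventually_1[OF this]
      have "\<forall>\<^sub>F k in sequentially. (cutoff k x - 1)\<^sup>2 * (norm (grad u x))\<^sup>2 = 0"
        by eventually_elim simp
      then show "(\<lambda>k. (cutoff k x - 1)\<^sup>2 * (norm (grad u x))\<^sup>2) \<longlonglongrightarrow> 0" by (rule tendsto_eventually)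
    qed
  qed (use ig ble in auto)
  then have b0: "b \<longlonglongrightarrow> 0" by simp

  define E where "E k = (\<integral>x. (u x)\<^sup>2 * (norm (grad (cutoff k) x))\<^sup>2 \<partial>lborel)" for k
  have iE: "integrable lborel (\<lambda>x. (u x)\<^sup>2 * (norm (grad (cutoff k) x))\<^sup>2)" for k
    by (rule integrable_compact_support[of _ "2 * real (Suc k) + 1"])
      (auto intro!: continuous_intros cu continuous_on_grad_cutoff grad_cutoff_far)
  have E0: "E \<longlonglongrightarrow> 0" unfolding E_def[abs_def] by (rule cutoff_error_tendsto_0[OF n cu iu])
  have nn: "a k \<ge> 0" "b k \<ge> 0" "E k \<ge> 0" for k
    unfolding a_def b_def E_def by (auto intro!: Bochner_Integration.integral_nonneg)

  have P: "Lp_norm_pow p (\<lambda>x. \<phi> k x - u x) \<le> ennreal (2 powr p * (\<delta> k + a k))" for k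
  proof -
    have "Lp_norm_pow p (\<lambda>x. \<phi> k x - u x)
        \<le> (\<integral>\<^sup>+x. ennreal (2 powr p) * (ennreal (\<bar>\<phi> k x - cutoff k x * u x\<bar> powr p)
            + ennreal (\<bar>(cutoff k x - 1) * u x\<bar> powr p)) \<partial>lborel)"
      unfolding Lp_norm_pow_eq
    proof (intro nn_integral_mono)
      fix x
      have "norm (\<phi> k x - u x) powr p \<le> (\<bar>\<phi> k x - cutoff k x * u x\<bar> + \<bar>(cutoff k x - 1) * u x\<bar>) powr p"
        using p abs_triangle_ineq[of "\<phi> k x - cutoff k x * u x" "(cutoff k x - 1) * u x"]
        by (intro powr_mono2) (auto simp: algebra_simps)
      also have "\<dots> \<le> 2 powr p * (\<bar>\<phi> k x - cutoff k x * u x\<bar> powr p + \<bar>(cutoff k x - 1) * u x\<bar> powr p)"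
        using p by (intro powr_add_le) auto
      finally show "ennreal (norm (\<phi> k x - u x) powr p) \<le> ennreal (2 powr p) *
          (ennreal (\<bar>\<phi> k x - cutoff k x * u x\<bar> powr p) + ennreal (\<bar>(cutoff k x - 1) * u x\<bar> powr p))"
        by (simp add: ennreal_leI ennreal_mult[symmetric] ennreal_plus[symmetric] del: ennreal_plus)
    qed
    also have "\<dots> = ennreal (2 powr p) * ((\<integral>\<^sup>+x. ennreal (\<bar>\<phi> k x - cutoff k x * u x\<bar> powr p) \<partial>lborel)
        + (\<integral>\<^sup>+x. ennreal (\<bar>(cutoff k x - 1) * u x\<bar> powr p) \<partial>lborel))"
      by (subst nn_integral_cmult) (auto simp: nn_integral_add)
    also have "(\<integral>\<^sup>+x. ennreal (\<bar>(cutoff k x - 1) * u x\<bar> powr p) \<partial>lborel) = ennreal (a k)"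
      unfolding a_def using ia by (intro nn_integral_eq_integral) auto
    also have "ennreal (2 powr p) * ((\<integral>\<^sup>+x. ennreal (\<bar>\<phi> k x - cutoff k x * u x\<bar> powr p) \<partial>lborel) + ennreal (a k))
        \<le> ennreal (2 powr p) * (ennreal (\<delta> k) + ennreal (a k))"
      by (intro mult_left_mono add_right_mono \<phi>(2)) auto
    also have "\<dots> = ennreal (2 powr p * (\<delta> k + a k))"
      using nn(1)[of k] \<delta>[of k] by (simp add: ennreal_mult)
    finally show ?thesis .
  qed
  have Plim: "(\<lambda>k. Lp_norm_pow p (\<lambda>x. \<phi> k x - u x)) \<longlonglongrightarrow> 0"
  proof (rule tendsto_sandwich[where f="\<lambda>_. 0"])
    have "(\<lambda>k. 2 powr p * (\<delta> k + a k)) \<longlonglongrightarrow> 2 powr p * (0 + 0)"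
      by (intro tendsto_intros a0 \<delta>0)
    then show "(\<lambda>k. ennreal (2 powr p * (\<delta> k + a k))) \<longlonglongrightarrow> 0"
      using tendsto_ennrealI by fastforce
  qed (use P in auto)

  \<comment> \<open>The factor 3 comes from squaring a sum of three terms, which are the errors of
    mollification, truncation and cutoff gradient.\<close>
  define q where "q k = 3 * (\<delta> k + b k + E k)" for k
  have "(\<lambda>k. 3 * (\<delta> k + b k + E k)) \<longlonglongrightarrow> 3 * (0 + 0 + 0)"
    by (intro tendsto_intros \<delta>0 b0 E0)
  then have q0: "q \<longlonglongrightarrow> 0" by (simp add: q_def[abs_def])
  have Q: "(\<integral>\<^sup>+x. ennreal ((norm (grad (\<phi> k) x - grad u x))\<^sup>2) \<partial>lborel) \<le> ennreal (q k)" for k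
  proof -
    let ?f1 = "\<lambda>x. (norm (grad (\<phi> k) x - Dv k x))\<^sup>2"
    let ?f2 = "\<lambda>x. (cutoff k x - 1)\<^sup>2 * (norm (grad u x))\<^sup>2"
    let ?f3 = "\<lambda>x. (u x)\<^sup>2 * (norm (grad (cutoff k) x))\<^sup>2"
    have "(\<integral>\<^sup>+x. ennreal ((norm (grad (\<phi> k) x - grad u x))\<^sup>2) \<partial>lborel)
        \<le> (\<integral>\<^sup>+x. ennreal 3 * (ennreal (?f1 x) + (ennreal (?f2 x) + ennreal (?f3 x))) \<partial>lborel)"
    proof (intro nn_integral_mono)
      fix x
      define c1 where "c1 = norm (grad (\<phi> k) x - Dv k x)"
      define c2 where "c2 = \<bar>cutoff k x - 1\<bar> * norm (grad u x)"
      define c3 where "c3 = \<bar>u x\<bar> * norm (grad (cutoff k) x)"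
      have "grad (\<phi> k) x - grad u x = (grad (\<phi> k) x - Dv k x)
          + ((cutoff k x - 1) *\<^sub>R grad u x + u x *\<^sub>R grad (cutoff k) x)"
        by (simp add: Dv_def algebra_simps)
      then have "norm (grad (\<phi> k) x - grad u x) \<le> c1 + (c2 + c3)"
        unfolding c1_def c2_def c3_def
        by (metis add_left_mono norm_scaleR norm_triangle_ineq norm_triangle_le)
      then have "(norm (grad (\<phi> k) x - grad u x))\<^sup>2 \<le> (c1 + (c2 + c3))\<^sup>2"
        by (intro power_mono) auto
      also have "\<dots> \<le> 3 * (c1\<^sup>2 + (c2\<^sup>2 + c3\<^sup>2))"
        using sum_squares_bound[of c1 c2] sum_squares_bound[of c1 c3] sum_squares_bound[of c2 c3]
        by (simp add: power2_sum algebra_simps)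
      finally show "ennreal ((norm (grad (\<phi> k) x - grad u x))\<^sup>2)
          \<le> ennreal 3 * (ennreal (?f1 x) + (ennreal (?f2 x) + ennreal (?f3 x)))"
        by (simp add: c1_def c2_def c3_def power_mult_distrib ennreal_leI ennreal_mult[symmetric]
            ennreal_plus[symmetric] del: ennreal_plus ennreal_numeral)
    qed
    also have "\<dots> = ennreal 3 * ((\<integral>\<^sup>+x. ennreal (?f1 x) \<partial>lborel)
        + ((\<integral>\<^sup>+x. ennreal (?f2 x) \<partial>lborel) + (\<integral>\<^sup>+x. ennreal (?f3 x) \<partial>lborel)))"
      by (subst nn_integral_cmult) (auto simp: nn_integral_add)
    also have "(\<integral>\<^sup>+x. ennreal (?f2 x) \<partial>lborel) = ennreal (b k)"
      unfolding b_def using ib by (intro nn_integral_eq_integral) auto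
    also have "(\<integral>\<^sup>+x. ennreal (?f3 x) \<partial>lborel) = ennreal (E k)"
      unfolding E_def using iE by (intro nn_integral_eq_integral) auto
    also have "ennreal 3 * ((\<integral>\<^sup>+x. ennreal (?f1 x) \<partial>lborel) + (ennreal (b k) + ennreal (E k)))
        \<le> ennreal 3 * (ennreal (\<delta> k) + (ennreal (b k) + ennreal (E k)))"
      by (intro mult_left_mono add_right_mono \<phi>(3)) auto
    also have "\<dots> = ennreal (q k)"
      using nn[of k] \<delta>[of k] unfolding q_def
      by (simp add: ennreal_mult[symmetric] ennreal_plus[symmetric] add.assoc del: ennreal_plus ennreal_numeral)
    finally show ?thesis .
  qed
  have cauchy: "\<exists>N. \<forall>j\<ge>N. \<forall>k\<ge>N. Lp_norm_pow 2 (grad (\<lambda>x. \<phi> j x - \<phi> k x)) < ennreal \<epsilon>" if "\<epsilon> > 0" for \<epsilon>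
  proof -
    \<comment> \<open>The squared L^2 distance of two gradients is at most
      \<open>2 * (q j + q k)\<close>, hence the quarter.\<close>
    have "\<forall>\<^sub>F k in sequentially. q k < \<epsilon> / 4" using q0 that by (intro order_tendstoD) auto
    then obtain N where N: "\<And>k. k \<ge> N \<Longrightarrow> q k < \<epsilon> / 4" unfolding eventually_sequentially by blast
    have "Lp_norm_pow 2 (grad (\<lambda>x. \<phi> j x - \<phi> k x)) < ennreal \<epsilon>" if jk: "j \<ge> N" "k \<ge> N" for j k
    proof -
      let ?h = "\<lambda>k x. (norm (grad (\<phi> k) x - grad u x))\<^sup>2"
      have "Lp_norm_pow 2 (grad (\<lambda>x. \<phi> j x - \<phi> k x)) \<le> (\<integral>\<^sup>+x. ennreal 2 * (ennreal (?h j x) + ennreal (?h k x)) \<partial>lborel)"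
        unfolding Lp_norm_pow_2_eq grad_diff_test_function[OF \<phi>(1) \<phi>(1)]
      proof (intro nn_integral_mono)
        fix x
        have "norm (grad (\<phi> j) x - grad (\<phi> k) x) \<le> norm (grad (\<phi> j) x - grad u x) + norm (grad (\<phi> k) x - grad u x)"
          using norm_triangle_ineq4[of "grad (\<phi> j) x - grad u x" "grad (\<phi> k) x - grad u x"] by simp
        then have "(norm (grad (\<phi> j) x - grad (\<phi> k) x))\<^sup>2 \<le> (norm (grad (\<phi> j) x - grad u x) + norm (grad (\<phi> k) x - grad u x))\<^sup>2"
          by (intro power_mono) auto
        also have "\<dots> \<le> 2 * (?h j x + ?h k x)"
          using sum_squares_bound[of "norm (grad (\<phi> j) x - grad u x)" "norm (grad (\<phi> k) x - grad u x)"]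
          by (simp add: power2_sum)
        finally show "ennreal ((norm (grad (\<phi> j) x - grad (\<phi> k) x))\<^sup>2) \<le> ennreal 2 * (ennreal (?h j x) + ennreal (?h k x))"
          by (simp add: ennreal_leI ennreal_mult[symmetric] ennreal_plus[symmetric] del: ennreal_plus ennreal_numeral)
      qed
      also have "\<dots> = ennreal 2 * ((\<integral>\<^sup>+x. ennreal (?h j x) \<partial>lborel) + (\<integral>\<^sup>+x. ennreal (?h k x) \<partial>lborel))"
        by (subst nn_integral_cmult) (auto simp: nn_integral_add)
      also have "\<dots> \<le> ennreal 2 * (ennreal (q j) + ennreal (q k))"
        by (intro mult_left_mono add_mono Q) auto
      also have "\<dots> = ennreal (2 * (q j + q k))"
        using nn \<delta> less_imp_le[OF \<delta>] by (simp add: q_def ennreal_mult[symmetric] ennreal_plus[symmetric] del: ennreal_plus ennreal_numeral)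
      also have "\<dots> < ennreal \<epsilon>"
        using N[OF jk(1)] N[OF jk(2)] \<open>\<epsilon> > 0\<close> by (intro ennreal_lessI) auto
      finally show ?thesis .
    qed
    then show ?thesis by blast
  qed
  have "u \<in> borel_measurable lebesgue"
    by (intro measurable_completion) measurable
  then show ?thesis
    unfolding D12_def using \<phi>(1) cauchy Plim unfolding p_def by blast
qed

section \<open>From the equation to the weighted integral\<close>

text \<open>This is the equation multiplied by \<open>u\<close>. At the origin the equation says
  nothing about \<open>laplacian u\<close>, and \<open>norm x powr (- t)\<close> is 0 by convention,
  so the integrals are compared almost everywhere.\<close>

lemma solution_weight:
  fixes u :: "real^'n \<Rightarrow> real"
  assumes "solves_eq t q u"
  shows "x \<noteq> 0 \<Longrightarrow> u x * - laplacian u x = norm x powr (- t) * u x powr (q + 1)"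
    and "(\<integral>\<^sup>+x. ennreal (u x * - laplacian u x) \<partial>lborel)
      = (\<integral>\<^sup>+x. ennreal (norm x powr (- t) * u x powr (q + 1)) \<partial>lebesgue)"
proof -
  show eq: "u x * - laplacian u x = norm x powr (- t) * u x powr (q + 1)" if "x \<noteq> 0" for x
  proof -
    have "u x > 0" "- laplacian u x = norm x powr (- t) * u x powr q"
      using assms that unfolding solves_eq_def by auto
    then show ?thesis by (simp add: powr_add)
  qed
  have "AE x in lborel. x \<noteq> (0::real^'n)" by (rule AE_lborel_singleton)
  then have "AE x in lborel. ennreal (u x * - laplacian u x) = ennreal (norm x powr (- t) * u x powr (q + 1))"
    by eventually_elim (rule arg_cong[OF eq])
  then show "(\<integral>\<^sup>+x. ennreal (u x * - laplacian u x) \<partial>lborel)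
      = (\<integral>\<^sup>+x. ennreal (norm x powr (- t) * u x powr (q + 1)) \<partial>lebesgue)"
    unfolding nn_integral_completion by (rule nn_integral_cong_AE)
qed

lemma weighted_Lp_norm_pow:
  fixes u :: "real^'n \<Rightarrow> real"
  assumes "q > 1" and "\<And>x. u x > 0"
  shows "Lp_norm_pow (q + 1) (\<lambda>x. norm x powr (- t / (q + 1)) * u x)
      = (\<integral>\<^sup>+x. ennreal (norm x powr (- t) * u x powr (q + 1)) \<partial>lebesgue)"
proof -
  have "norm (norm x powr (- t / (q + 1)) * u x) powr (q + 1) = norm x powr (- t) * u x powr (q + 1)" for x
    using assms(1) less_imp_le[OF assms(2)[of x]] by (simp add: abs_mult powr_mult powr_powr)
  then show ?thesis by (simp add: Lp_norm_pow_def)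
qed

theorem proposition2p2:
  fixes t q :: real
  assumes "CARD('n::finite) \<ge> 3"
    and "0 < t" "t < 2"
    and "q > 1"
  shows "(\<forall>u :: real^'n \<Rightarrow> real.
            continuous_on UNIV u \<and> Ck_on 2 (- {0}) u \<and> u \<in> D12 \<and> solves_eq t q u \<longrightarrow>
              Lp_norm_pow (q + 1) (\<lambda>x. norm x powr (- t / (q + 1)) * u x) < \<infinity> \<and>
              Lp_norm_pow (q + 1) (\<lambda>x. norm x powr (- t / (q + 1)) * u x)
                = Lp_norm_pow 2 (grad u)) \<and>
         (\<forall>u :: real^'n \<Rightarrow> real.
            continuous_on UNIV u \<and> Ck_on 2 (- {0}) u \<and> solves_eq t q u \<and>
            (\<integral>\<^sup>+x. ennreal (norm x powr (- t) * u x powr (q + 1)) \<partial>lebesgue) < \<infinity> \<and>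
            u \<in> Lp_space (2 * real CARD('n) / (real CARD('n) - 2)) \<longrightarrow>
              u \<in> D12 \<and>
              (\<integral>\<^sup>+x. ennreal ((norm (grad u x))\<^sup>2) \<partial>lebesgue)
                = (\<integral>\<^sup>+x. ennreal (norm x powr (- t) * u x powr (q + 1)) \<partial>lebesgue))"
proof (intro conjI allI impI)
  fix u :: "real^'n \<Rightarrow> real"
  assume *: "continuous_on UNIV u \<and> Ck_on 2 (- {0}) u \<and> u \<in> D12 \<and> solves_eq t q u"
  have u: "C2_off_origin u" and D12: "u \<in> D12" and eq: "solves_eq t q u" and cu: "continuous_on UNIV u"
    using * by (auto simp: C2_off_origin_def)
  have pos: "u x > 0" for x using eq by (simp add: solves_eq_def)
  have nn: "u x * - laplacian u x \<ge> 0" if "x \<noteq> 0" for x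
    unfolding solution_weight(1)[OF eq that] by simp
  have iu: "integrable lborel (\<lambda>x. \<bar>u x\<bar> powr (2 * real CARD('n) / (real CARD('n) - 2)))"
    by (rule D12_imp_bounds[OF assms(1) D12 cu])
  \<comment> \<open>Membership in \<open>D12\<close> supplies the gradient alternative of
    \<open>energy_equality\<close>.\<close>
  have e: "(\<integral>\<^sup>+x. ennreal ((norm (grad u x))\<^sup>2) \<partial>lborel) = (\<integral>\<^sup>+x. ennreal (u x * - laplacian u x) \<partial>lborel)"
      "(\<integral>\<^sup>+x. ennreal ((norm (grad u x))\<^sup>2) \<partial>lborel) < \<infinity>"
    by (rule energy_equality[OF assms(1) u iu nn
          disjI1[OF D12_imp_cutoff_energy_bounded[OF assms(1) u D12]]], assumption)+
  show "Lp_norm_pow (q + 1) (\<lambda>x. norm x powr (- t / (q + 1)) * u x) = Lp_norm_pow 2 (grad u)"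
    using e(1) solution_weight(2)[OF eq]
    by (simp only: weighted_Lp_norm_pow[OF assms(4) pos] Lp_norm_pow_2_eq)
  then show "Lp_norm_pow (q + 1) (\<lambda>x. norm x powr (- t / (q + 1)) * u x) < \<infinity>"
    using e(2) by (simp add: Lp_norm_pow_2_eq)
next
  fix u :: "real^'n \<Rightarrow> real"
  assume *: "continuous_on UNIV u \<and> Ck_on 2 (- {0}) u \<and> solves_eq t q u \<and>
    (\<integral>\<^sup>+x. ennreal (norm x powr (- t) * u x powr (q + 1)) \<partial>lebesgue) < \<infinity> \<and>
    u \<in> Lp_space (2 * real CARD('n) / (real CARD('n) - 2))"
  have u: "C2_off_origin u" and eq: "solves_eq t q u" and cu: "continuous_on UNIV u"
    and fin: "(\<integral>\<^sup>+x. ennreal (norm x powr (- t) * u x powr (q + 1)) \<partial>lebesgue) < \<infinity>"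
    and L: "Lp_norm_pow (2 * real CARD('n) / (real CARD('n) - 2)) u < \<infinity>"
    using * by (auto simp: C2_off_origin_def Lp_space_def)
  have nn: "u x * - laplacian u x \<ge> 0" if "x \<noteq> 0" for x
    unfolding solution_weight(1)[OF eq that] by simp
  have [measurable]: "u \<in> borel_measurable borel" by (rule borel_measurable_continuous_onI[OF cu])
  have iu: "integrable lborel (\<lambda>x. \<bar>u x\<bar> powr (2 * real CARD('n) / (real CARD('n) - 2)))"
    using L by (intro finite_nn_integral_imp_integrable) (auto simp: Lp_norm_pow_eq)
  have cw: "continuous_on (- {0}) (\<lambda>x. u x * - laplacian u x)"
    by (intro continuous_intros continuous_on_laplacian[OF u] continuous_on_subset[OF cu]) auto
  have AE0: "AE x in lborel. x \<noteq> (0::real^'n)" by (rule AE_lborel_singleton)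
  have AEw: "AE x in lborel. u x * - laplacian u x \<ge> 0"
    using AE0 by eventually_elim (rule nn)
  have iw: "integrable lborel (\<lambda>x. u x * - laplacian u x)"
    using fin[folded solution_weight(2)[OF eq]] borel_measurable_off_origin[OF cw] AEw
    by (intro integrableI_nonneg) auto
  \<comment> \<open>Since \<eta>^2 \<le> 1, the full weighted integral bounds every cutoff energy;
    this is the other alternative of \<open>energy_equality\<close>.\<close>
  have "(\<integral>x. (cutoff k x)\<^sup>2 * (u x * - laplacian u x) \<partial>lborel) \<le> (\<integral>x. u x * - laplacian u x \<partial>lborel)" for k
  proof (rule integral_mono_AE[OF integrable_cutoff_sq_mult[OF cw] iw])
    show "AE x in lborel. (cutoff k x)\<^sup>2 * (u x * - laplacian u x) \<le> u x * - laplacian u x"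
      using AEw
      by eventually_elim (intro mult_left_le_one_le zero_le_power2 power_le_one cutoff_range)
  qed
  then have bdd: "\<exists>M. \<forall>k. (\<integral>x. (cutoff k x)\<^sup>2 * (u x * - laplacian u x) \<partial>lborel) \<le> M" by blast
  have e: "(\<integral>\<^sup>+x. ennreal ((norm (grad u x))\<^sup>2) \<partial>lborel) = (\<integral>\<^sup>+x. ennreal (u x * - laplacian u x) \<partial>lborel)"
      "(\<integral>\<^sup>+x. ennreal ((norm (grad u x))\<^sup>2) \<partial>lborel) < \<infinity>"
    by (rule energy_equality[OF assms(1) u iu nn disjI2[OF bdd]], assumption)+
  have "continuous_on (- {0}) (\<lambda>x. (norm (grad u x))\<^sup>2)"
    by (intro continuous_intros C2_off_origin_GDERIV(2)[OF u])
  \<comment> \<open>The finiteness just obtained is, besides the L^p bound, what \<open>D12I\<close>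
    asks for.\<close>
  then have "integrable lborel (\<lambda>x. (norm (grad u x))\<^sup>2)"
    using e(2) borel_measurable_off_origin by (intro finite_nn_integral_imp_integrable) auto
  then show "u \<in> D12" by (rule D12I[OF assms(1) u iu])
  show "(\<integral>\<^sup>+x. ennreal ((norm (grad u x))\<^sup>2) \<partial>lebesgue)
      = (\<integral>\<^sup>+x. ennreal (norm x powr (- t) * u x powr (q + 1)) \<partial>lebesgue)"
    using e(1) solution_weight(2)[OF eq] by (simp only: nn_integral_completion)
qed

end
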